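(* Let $G$ and $H$ be finitely generated groups, and let $G*H$ be their free product. Then \[ \operatorname{sep}_{G*H}(r)\simeq \max\{\operatorname{sep}_G(r),\operatorname{sep}_H(r)\}. \]
   Context: For a finite graph $\Gamma=(V\Gamma,E\Gamma)$, the cutsize $\operatorname{cut}(\Gamma)$ is the minimum cardinality of a subset $S\subseteq V\Gamma$ such that every connected component of $\Gamma-S$ contains at most $\frac12|V\Gamma|$ vertices. For any graph $X$, the separation profile of $X$ is the function $\operatorname{sep}_X:\mathbb N\to\mathbb N$, \[ \operatorname{sep}_X(r)=\max\{\operatorname{cut}(\Gamma) : \Gamma\leq X,\ |V\Gamma|\leq r\}, \] where $\Gamma\leq X$ means $\Gamma$ is a (finite) subgraph of $X$. For functions $f,g:\mathbb N\to\mathbb N$, write $f\lesssim g$ if there is a constant $C$ such that $f(r)\leq Cg(Cr)+C$ for all $r\in\mathbb N$, and $f\simeq g$ if $f\lesssim g$ and $g\lesssim f$. For a finitely generated group $G$, $\operatorname{sep}_G$ denotes the separation profile of a Cayley graph of $G$ with respect to a finite generating set. It is considered up to $\simeq$, and up to $\simeq$ it does not depend on the choice of finite generating set. *)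

theory Defs
  imports "HOL-Algebra.Generated_Groups"
begin

section \<open>Graphs, cutsize and separation profile\<close>

text \<open>A graph is a pair of a vertex set and a symmetric, irreflexive adjacency relation;
  the empty graph is allowed.\<close>

type_synonym 'a ugraph = "'a set \<times> ('a \<times> 'a) set"

abbreviation verts :: "'a ugraph \<Rightarrow> 'a set" where "verts \<equiv> fst"

abbreviation edges :: "'a ugraph \<Rightarrow> ('a \<times> 'a) set" where "edges \<equiv> snd"

definition ugraph :: "'a ugraph \<Rightarrow> bool" where
  "ugraph X \<longleftrightarrow> edges X \<subseteq> verts X \<times> verts X \<and> sym (edges X) \<and> irrefl (edges X)"

definition ugraph_subgraph :: "'a ugraph \<Rightarrow> 'a ugraph \<Rightarrow> bool" where
  "ugraph_subgraph Y X \<longleftrightarrow> ugraph Y \<and> verts Y \<subseteq> verts X \<and> edges Y \<subseteq> edges X"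

definition delete_verts :: "'a ugraph \<Rightarrow> 'a set \<Rightarrow> 'a ugraph" where
  "delete_verts X S =
     (verts X - S, edges X \<inter> ((verts X - S) \<times> (verts X - S)))"

definition components :: "'a ugraph \<Rightarrow> 'a set set" where
  "components X = (\<lambda>v. {w \<in> verts X. (v, w) \<in> (edges X)\<^sup>*}) ` verts X"

definition separates :: "'a ugraph \<Rightarrow> 'a set \<Rightarrow> bool" where
  "separates X S \<longleftrightarrow> S \<subseteq> verts X \<and>
     (\<forall>C \<in> components (delete_verts X S). 2 * card C \<le> card (verts X))"

definition cut :: "'a ugraph \<Rightarrow> nat" where
  "cut X = Min {card S | S. separates X S}"

definition sep :: "'a ugraph \<Rightarrow> nat \<Rightarrow> nat" where
  "sep X r = Max {cut Y | Y. ugraph_subgraph Y X \<and> finite (verts Y) \<and> card (verts Y) \<le> r}"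

text \<open>Both extrema range over finite nonempty sets.\<close>

lemma separates_verts: "separates X (verts X)"
  by (simp add: separates_def components_def delete_verts_def)

lemma finite_cut_set: "finite (verts X) \<Longrightarrow> finite {card S | S. separates X S}"
  by (rule finite_subset[of _ "card ` Pow (verts X)"]) (auto simp: separates_def)

lemma cut_le_card: "finite (verts X) \<Longrightarrow> cut X \<le> card (verts X)"
  unfolding cut_def using finite_cut_set[of X] separates_verts[of X]
  by (intro Min_le) auto

lemma sep_set_finite_nonempty:
  fixes X :: "'a ugraph" and r :: nat
  defines "A \<equiv> {cut Y | Y. ugraph_subgraph Y X \<and> finite (verts Y) \<and> card (verts Y) \<le> r}"
  shows "finite A" and "A \<noteq> {}"
proof -
  have "A \<subseteq> {..r}"
    unfolding A_def using cut_le_card order_trans by blast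
  then show "finite A" by (rule finite_subset) simp
  have "cut ({}, {} :: ('a \<times> 'a) set) \<in> A"
    unfolding A_def ugraph_subgraph_def ugraph_def
    by (intro CollectI exI[of _ "({}, {})"]) (simp add: sym_def irrefl_def)
  then show "A \<noteq> {}" by blast
qed


section \<open>Asymptotic comparison\<close>

definition asymp_le :: "(nat \<Rightarrow> nat) \<Rightarrow> (nat \<Rightarrow> nat) \<Rightarrow> bool" (infix \<open>\<lesssim>\<^sub>s\<close> 50) where
  "f \<lesssim>\<^sub>s g \<longleftrightarrow> (\<exists>C. \<forall>r. f r \<le> C * g (C * r) + C)"

definition asymp_eq :: "(nat \<Rightarrow> nat) \<Rightarrow> (nat \<Rightarrow> nat) \<Rightarrow> bool" (infix \<open>\<simeq>\<^sub>s\<close> 50) where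
  "f \<simeq>\<^sub>s g \<longleftrightarrow> f \<lesssim>\<^sub>s g \<and> g \<lesssim>\<^sub>s f"


section \<open>Cayley graphs\<close>

definition finite_generating_set :: "('a, 'm) monoid_scheme \<Rightarrow> 'a set \<Rightarrow> bool" where
  "finite_generating_set G S \<longleftrightarrow>
     finite S \<and> S \<subseteq> carrier G \<and> generate G S = carrier G"

text \<open>Generating sets need not be symmetric and may contain the identity: edges are
  symmetrised and loops are discarded.\<close>

definition cayley_graph :: "('a, 'm) monoid_scheme \<Rightarrow> 'a set \<Rightarrow> 'a ugraph" where
  "cayley_graph G S = (carrier G,
     {(g, h). g \<in> carrier G \<and> h \<in> carrier G \<and> g \<noteq> h \<and>
        (\<exists>s\<in>S. h = g \<otimes>\<^bsub>G\<^esub> s \<or> g = h \<otimes>\<^bsub>G\<^esub> s)})"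

lemma ugraph_cayley_graph: "ugraph (cayley_graph G S)"
  by (auto simp: ugraph_def cayley_graph_def sym_def irrefl_def)


section \<open>Free products\<close>

text \<open>The free product is constructed on reduced words: lists of non-identity letters from
  the two factors in which neighbouring letters come from different factors.\<close>

definition fp_words ::
  "('a, 'm) monoid_scheme \<Rightarrow> ('b, 'n) monoid_scheme \<Rightarrow> ('a + 'b) list set" where
  "fp_words G H = {w.
     set w \<subseteq> Inl ` (carrier G - {\<one>\<^bsub>G\<^esub>}) \<union> Inr ` (carrier H - {\<one>\<^bsub>H\<^esub>}) \<and>
     successively (\<lambda>x y. isl x \<noteq> isl y) w}"

text \<open>Left multiplication of a reduced word by a single, possibly trivial, letter.\<close>

fun fp_cons ::
  "('a, 'm) monoid_scheme \<Rightarrow> ('b, 'n) monoid_scheme \<Rightarrow> 'a + 'b \<Rightarrow> ('a + 'b) list \<Rightarrow> ('a + 'b) list"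
where
  "fp_cons G H (Inl a) (Inl b # w) =
     (if a \<otimes>\<^bsub>G\<^esub> b = \<one>\<^bsub>G\<^esub> then w else Inl (a \<otimes>\<^bsub>G\<^esub> b) # w)"
| "fp_cons G H (Inr a) (Inr b # w) =
     (if a \<otimes>\<^bsub>H\<^esub> b = \<one>\<^bsub>H\<^esub> then w else Inr (a \<otimes>\<^bsub>H\<^esub> b) # w)"
| "fp_cons G H (Inl a) w = (if a = \<one>\<^bsub>G\<^esub> then w else Inl a # w)"
| "fp_cons G H (Inr a) w = (if a = \<one>\<^bsub>H\<^esub> then w else Inr a # w)"

definition free_product ::
  "('a, 'm) monoid_scheme \<Rightarrow> ('b, 'n) monoid_scheme \<Rightarrow> ('a + 'b) list monoid" where
  "free_product G H =
     \<lparr>carrier = fp_words G H, mult = (\<lambda>u v. foldr (fp_cons G H) u v), one = []\<rparr>"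

definition fp_inl ::
  "('a, 'm) monoid_scheme \<Rightarrow> ('b, 'n) monoid_scheme \<Rightarrow> 'a \<Rightarrow> ('a + 'b) list" where
  "fp_inl G H a = fp_cons G H (Inl a) []"

definition fp_inr ::
  "('a, 'm) monoid_scheme \<Rightarrow> ('b, 'n) monoid_scheme \<Rightarrow> 'b \<Rightarrow> ('a + 'b) list" where
  "fp_inr G H b = fp_cons G H (Inr b) []"


subsection \<open>The construction is a group and a coproduct\<close>

locale two_groups = G: group G + H: group H
  for G :: "('a, 'm) monoid_scheme" (structure) and H :: "('b, 'n) monoid_scheme" (structure)
begin

abbreviation "letters \<equiv> Inl ` carrier G \<union> Inr ` carrier H"

lemma fp_words_Nil: "[] \<in> fp_words G H"
  by (simp add: fp_words_def)

lemma fp_words_letters: "w \<in> fp_words G H \<Longrightarrow> set w \<subseteq> letters"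
  by (auto simp: fp_words_def)

lemma fp_words_Cons: "x # w \<in> fp_words G H \<Longrightarrow> w \<in> fp_words G H"
  by (auto simp: fp_words_def successively_Cons)

lemma fp_cons_Cons: "x # w \<in> fp_words G H \<Longrightarrow> fp_cons G H x w = x # w"
  by (cases "(G, H, x, w)" rule: fp_cons.cases) (auto simp: fp_words_def)

lemma fp_cons_closed:
  assumes "x \<in> letters" "w \<in> fp_words G H"
  shows "fp_cons G H x w \<in> fp_words G H"
proof (cases w)
  case Nil
  then show ?thesis using assms by (auto simp: fp_words_def split: if_splits)
next
  case (Cons y v)
  show ?thesis
  proof (cases v)
    case Nil
    then show ?thesis using assms Cons
      by (cases x; cases y) (auto simp: fp_words_def)
  next
    case v: (Cons z u)
    then show ?thesis using assms Cons
      by (cases x; cases y; cases z) (auto simp: fp_words_def)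
  qed
qed

lemma fp_cons_Inl_Inl:
  assumes "a \<in> carrier G" "b \<in> carrier G" "w \<in> fp_words G H"
  shows "fp_cons G H (Inl a) (fp_cons G H (Inl b) w) = fp_cons G H (Inl (a \<otimes>\<^bsub>G\<^esub> b)) w"
proof (cases w)
  case Nil
  then show ?thesis using assms by auto
next
  case (Cons y v)
  show ?thesis
  proof (cases y)
    case (Inr d)
    then show ?thesis using assms Cons by auto
  next
    case (Inl d)
    then have d: "d \<in> carrier G" "d \<noteq> \<one>\<^bsub>G\<^esub>" using assms Cons by (auto simp: fp_words_def)
    have av: "fp_cons G H (Inl a) v = (if a = \<one>\<^bsub>G\<^esub> then v else Inl a # v)"
      using assms(3) Cons Inl by (cases v; cases "hd v") (auto simp: fp_words_def)
    have ad: "a \<otimes>\<^bsub>G\<^esub> b \<otimes>\<^bsub>G\<^esub> d = a \<otimes>\<^bsub>G\<^esub> (b \<otimes>\<^bsub>G\<^esub> d)"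
      using assms d by (simp add: G.m_assoc)
    show ?thesis using assms d av ad Cons Inl
      by (cases "b \<otimes>\<^bsub>G\<^esub> d = \<one>\<^bsub>G\<^esub>") auto
  qed
qed

lemma fp_cons_Inr_Inr:
  assumes "a \<in> carrier H" "b \<in> carrier H" "w \<in> fp_words G H"
  shows "fp_cons G H (Inr a) (fp_cons G H (Inr b) w) = fp_cons G H (Inr (a \<otimes>\<^bsub>H\<^esub> b)) w"
proof (cases w)
  case Nil
  then show ?thesis using assms by auto
next
  case (Cons y v)
  show ?thesis
  proof (cases y)
    case (Inl d)
    then show ?thesis using assms Cons by auto
  next
    case (Inr d)
    then have d: "d \<in> carrier H" "d \<noteq> \<one>\<^bsub>H\<^esub>" using assms Cons by (auto simp: fp_words_def)
    have av: "fp_cons G H (Inr a) v = (if a = \<one>\<^bsub>H\<^esub> then v else Inr a # v)"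
      using assms(3) Cons Inr by (cases v; cases "hd v") (auto simp: fp_words_def)
    have ad: "a \<otimes>\<^bsub>H\<^esub> b \<otimes>\<^bsub>H\<^esub> d = a \<otimes>\<^bsub>H\<^esub> (b \<otimes>\<^bsub>H\<^esub> d)"
      using assms d by (simp add: H.m_assoc)
    show ?thesis using assms d av ad Cons Inr
      by (cases "b \<otimes>\<^bsub>H\<^esub> d = \<one>\<^bsub>H\<^esub>") auto
  qed
qed

lemma fp_cons_one:
  assumes "w \<in> fp_words G H"
  shows "fp_cons G H (Inl \<one>\<^bsub>G\<^esub>) w = w" "fp_cons G H (Inr \<one>\<^bsub>H\<^esub>) w = w"
  using assms by (cases w; cases "hd w"; auto simp: fp_words_def)+

lemma foldr_closed:
  "set u \<subseteq> letters \<Longrightarrow> w \<in> fp_words G H \<Longrightarrow> foldr (fp_cons G H) u w \<in> fp_words G H"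
  by (induction u) (auto intro!: fp_cons_closed)

lemma foldr_fp_cons:
  assumes "x \<in> letters" "t \<in> fp_words G H" "w \<in> fp_words G H"
  shows "foldr (fp_cons G H) (fp_cons G H x t) w = fp_cons G H x (foldr (fp_cons G H) t w)"
proof (cases t)
  case Nil
  then show ?thesis using assms fp_cons_one by (cases x) auto
next
  case (Cons y v)
  have v: "foldr (fp_cons G H) v w \<in> fp_words G H"
    using assms Cons by (intro foldr_closed fp_words_letters) (auto dest: fp_words_Cons)
  have y: "y \<in> letters" using assms Cons by (auto simp: fp_words_def)
  have z: "foldr (fp_cons G H) (y # v) w \<in> fp_words G H"
    using y v by (simp add: fp_cons_closed)
  note inl = fp_cons_Inl_Inl[OF _ _ v] and inr = fp_cons_Inr_Inr[OF _ _ v]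
  show ?thesis
  proof (cases x)
    case x: (Inl a)
    show ?thesis
    proof (cases y)
      case (Inl b)
      then show ?thesis using assms(1) y x Cons inl[of a b] fp_cons_one(1)[OF v] by auto
    next
      case (Inr b)
      then show ?thesis using assms(1) y x Cons fp_cons_one(1)[OF z] by auto
    qed
  next
    case x: (Inr a)
    show ?thesis
    proof (cases y)
      case (Inr b)
      then show ?thesis using assms(1) y x Cons inr[of a b] fp_cons_one(2)[OF v] by auto
    next
      case (Inl b)
      then show ?thesis using assms(1) y x Cons fp_cons_one(2)[OF z] by auto
    qed
  qed
qed

lemma foldr_assoc:
  assumes "v \<in> fp_words G H" "w \<in> fp_words G H" "set u \<subseteq> letters"
  shows "foldr (fp_cons G H) (foldr (fp_cons G H) u v) w =
    foldr (fp_cons G H) u (foldr (fp_cons G H) v w)"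
  using assms(3)
proof (induction u)
  case (Cons x u)
  then show ?case
    using assms foldr_closed[of u v] foldr_fp_cons[of x "foldr (fp_cons G H) u v" w] by auto
qed simp

lemma foldr_Nil: "u \<in> fp_words G H \<Longrightarrow> foldr (fp_cons G H) u [] = u"
proof (induction u)
  case (Cons x u)
  then show ?case using fp_words_Cons[OF Cons.prems] fp_cons_Cons[OF Cons.prems] by simp
qed simp

lemma fp_cons_inverse:
  assumes "x \<in> letters"
  shows "\<exists>y \<in> letters. \<forall>w \<in> fp_words G H. fp_cons G H y (fp_cons G H x w) = w"
proof (cases x)
  case (Inl a)
  then show ?thesis using assms fp_cons_Inl_Inl[of "inv\<^bsub>G\<^esub> a" a] fp_cons_one
    by (intro bexI[of _ "Inl (inv\<^bsub>G\<^esub> a)"]) auto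
next
  case (Inr a)
  then show ?thesis using assms fp_cons_Inr_Inr[of "inv\<^bsub>H\<^esub> a" a] fp_cons_one
    by (intro bexI[of _ "Inr (inv\<^bsub>H\<^esub> a)"]) auto
qed

lemma foldr_inverse:
  assumes "set u \<subseteq> letters"
  shows "\<exists>v. set v \<subseteq> letters \<and>
    (\<forall>w \<in> fp_words G H. foldr (fp_cons G H) v (foldr (fp_cons G H) u w) = w)"
  using assms
proof (induction u)
  case Nil
  show ?case by (intro exI[of _ "[]"]) auto
next
  case (Cons x u)
  obtain v where v: "set v \<subseteq> letters"
    "\<forall>w \<in> fp_words G H. foldr (fp_cons G H) v (foldr (fp_cons G H) u w) = w"
    using Cons by auto
  obtain y where y: "y \<in> letters" "\<forall>w \<in> fp_words G H. fp_cons G H y (fp_cons G H x w) = w"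
    using fp_cons_inverse[of x] Cons by auto
  show ?case
    using v y foldr_closed[of u] Cons.prems by (intro exI[of _ "v @ [y]"]) auto
qed

lemma group_free_product: "group (free_product G H)"
proof (rule groupI)
  fix x assume x: "x \<in> carrier (free_product G H)"
  then have x': "x \<in> fp_words G H" by (simp add: free_product_def)
  obtain v where v: "set v \<subseteq> letters"
    "\<forall>w \<in> fp_words G H. foldr (fp_cons G H) v (foldr (fp_cons G H) x w) = w"
    using foldr_inverse[OF fp_words_letters[OF x']] by auto
  have "foldr (fp_cons G H) (foldr (fp_cons G H) v []) x = []"
    using foldr_assoc[OF fp_words_Nil x' v(1)] v(2) foldr_Nil[OF x'] fp_words_Nil
    by (metis foldr.simps(1) id_apply)
  then show "\<exists>y\<in>carrier (free_product G H). y \<otimes>\<^bsub>free_product G H\<^esub> x = \<one>\<^bsub>free_product G H\<^esub>"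
    using foldr_closed[OF v(1) fp_words_Nil] by (auto simp: free_product_def)
qed (auto simp: free_product_def fp_words_Nil foldr_closed foldr_assoc fp_words_letters)

lemma fp_inl_hom: "fp_inl G H \<in> hom G (free_product G H)"
proof (rule homI)
  fix a b assume ab: "a \<in> carrier G" "b \<in> carrier G"
  show "fp_inl G H (a \<otimes>\<^bsub>G\<^esub> b) = fp_inl G H a \<otimes>\<^bsub>free_product G H\<^esub> fp_inl G H b"
    using ab foldr_fp_cons[of "Inl a" "[]" "fp_inl G H b"] fp_words_Nil
      fp_cons_closed[of "Inl b" "[]"] fp_cons_Inl_Inl[of a b "[]"]
    by (simp add: fp_inl_def free_product_def)
qed (auto simp: fp_inl_def free_product_def fp_words_def)

lemma fp_inr_hom: "fp_inr G H \<in> hom H (free_product G H)"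
proof (rule homI)
  fix a b assume ab: "a \<in> carrier H" "b \<in> carrier H"
  show "fp_inr G H (a \<otimes>\<^bsub>H\<^esub> b) = fp_inr G H a \<otimes>\<^bsub>free_product G H\<^esub> fp_inr G H b"
    using ab foldr_fp_cons[of "Inr a" "[]" "fp_inr G H b"] fp_words_Nil
      fp_cons_closed[of "Inr b" "[]"] fp_cons_Inr_Inr[of a b "[]"]
    by (simp add: fp_inr_def free_product_def)
qed (auto simp: fp_inr_def free_product_def fp_words_def)

lemma fp_inj: "inj_on (fp_inl G H) (carrier G)" "inj_on (fp_inr G H) (carrier H)"
  by (auto simp: inj_on_def fp_inl_def fp_inr_def split: if_splits)

lemma fp_cons_mult:
  "x # w \<in> fp_words G H \<Longrightarrow>
    x # w = (case x of Inl a \<Rightarrow> fp_inl G H a | Inr b \<Rightarrow> fp_inr G H b) \<otimes>\<^bsub>free_product G H\<^esub> w"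
  using fp_cons_Cons[of x w]
  by (auto simp: free_product_def fp_inl_def fp_inr_def fp_words_def split: sum.split)

lemma generate_free_product:
  "generate (free_product G H) (fp_inl G H ` carrier G \<union> fp_inr G H ` carrier H) =
    carrier (free_product G H)" (is "generate ?P ?A = _")
proof
  interpret P: group ?P by (rule group_free_product)
  have A: "?A \<subseteq> carrier ?P" using fp_inl_hom fp_inr_hom by (auto simp: hom_def)
  show "generate ?P ?A \<subseteq> carrier ?P" using P.generate_incl[OF A] .
  have "w \<in> generate ?P ?A" if "w \<in> fp_words G H" for w
    using that
  proof (induction w)
    case Nil
    show ?case using generate.one[of ?P ?A] by (simp add: free_product_def)
  next
    case (Cons x w)
    have x: "(case x of Inl a \<Rightarrow> fp_inl G H a | Inr b \<Rightarrow> fp_inr G H b) \<in> generate ?P ?A"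
      using Cons.prems by (auto simp: fp_words_def intro!: generate.incl)
    show ?case
      using generate.eng[OF x Cons.IH[OF fp_words_Cons[OF Cons.prems]]]
        fp_cons_mult[OF Cons.prems] by simp
  qed
  then show "carrier ?P \<subseteq> generate ?P ?A" by (auto simp: free_product_def)
qed

lemma finite_generating_set_free_product:
  assumes S: "finite_generating_set G S" and T: "finite_generating_set H T"
  shows "finite_generating_set (free_product G H) (fp_inl G H ` S \<union> fp_inr G H ` T)"
    (is "finite_generating_set ?P ?A")
proof -
  interpret P: group ?P by (rule group_free_product)
  interpret l: group_hom G ?P "fp_inl G H"
    using fp_inl_hom by unfold_locales
  interpret r: group_hom H ?P "fp_inr G H"
    using fp_inr_hom by unfold_locales
  have A: "?A \<subseteq> carrier ?P"
    using S T fp_inl_hom fp_inr_hom by (auto simp: finite_generating_set_def hom_def)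
  have "fp_inl G H ` carrier G \<subseteq> generate ?P ?A"
    using l.generate_img[of S] S P.mono_generate[of "fp_inl G H ` S" ?A]
    by (auto simp: finite_generating_set_def)
  moreover have "fp_inr G H ` carrier H \<subseteq> generate ?P ?A"
    using r.generate_img[of T] T P.mono_generate[of "fp_inr G H ` T" ?A]
    by (auto simp: finite_generating_set_def)
  ultimately have "generate ?P (fp_inl G H ` carrier G \<union> fp_inr G H ` carrier H) \<subseteq> generate ?P ?A"
    by (intro P.generate_subgroup_incl P.generate_is_subgroup A) auto
  then show ?thesis
    using S T A P.generate_incl[OF A] generate_free_product
    by (auto simp: finite_generating_set_def)
qed

lemma free_product_universal:
  fixes K (structure)
  assumes K: "group K" and f: "f \<in> hom G K" and h: "h \<in> hom H K"
  shows "\<exists>\<phi> \<in> hom (free_product G H) K.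
      (\<forall>a \<in> carrier G. \<phi> (fp_inl G H a) = f a) \<and> (\<forall>b \<in> carrier H. \<phi> (fp_inr G H b) = h b) \<and>
      (\<forall>\<psi> \<in> hom (free_product G H) K.
        (\<forall>a \<in> carrier G. \<psi> (fp_inl G H a) = f a) \<longrightarrow>
        (\<forall>b \<in> carrier H. \<psi> (fp_inr G H b) = h b) \<longrightarrow>
        (\<forall>w \<in> carrier (free_product G H). \<psi> w = \<phi> w))"
proof -
  interpret K: group K by (rule K)
  interpret f: group_hom G K f using f by unfold_locales
  interpret h: group_hom H K h using h by unfold_locales
  let ?P = "free_product G H"
  define e where "e x = (case x of Inl a \<Rightarrow> f a | Inr b \<Rightarrow> h b)" for x
  define \<phi> where "\<phi> w = foldr (\<lambda>x k. e x \<otimes>\<^bsub>K\<^esub> k) w \<one>\<^bsub>K\<^esub>" for w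
  have e: "e x \<in> carrier K" if "x \<in> letters" for x
    using that by (auto simp: e_def)
  have \<phi>: "\<phi> w \<in> carrier K" if "set w \<subseteq> letters" for w
    using that by (induction w) (auto simp: \<phi>_def intro!: K.m_closed e)
  have \<phi>_Cons: "\<phi> (x # w) = e x \<otimes>\<^bsub>K\<^esub> \<phi> w" for x w by (simp add: \<phi>_def)
  have cons: "\<phi> (fp_cons G H x w) = e x \<otimes>\<^bsub>K\<^esub> \<phi> w" if "x \<in> letters" "set w \<subseteq> letters" for x w
  proof (cases w)
    case Nil
    then show ?thesis using that by (cases x) (auto simp: \<phi>_def e_def)
  next
    case (Cons y v)
    have y: "y \<in> letters" and v: "\<phi> v \<in> carrier K" using that Cons \<phi>[of v] by auto
    have as: "e x \<otimes>\<^bsub>K\<^esub> (e y \<otimes>\<^bsub>K\<^esub> \<phi> v) = (e x \<otimes>\<^bsub>K\<^esub> e y) \<otimes>\<^bsub>K\<^esub> \<phi> v"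
      using e[OF that(1)] e[OF y] v by (simp add: K.m_assoc)
    have e1: "e y \<otimes>\<^bsub>K\<^esub> \<phi> v \<in> carrier K" using e[OF y] v by simp
    show ?thesis
    proof (cases x)
      case x: (Inl a)
      then have a: "a \<in> carrier G" using that by auto
      show ?thesis
      proof (cases y)
        case (Inl b)
        then have "b \<in> carrier G" using y by auto
        then have E: "e x \<otimes>\<^bsub>K\<^esub> \<phi> w = f (a \<otimes>\<^bsub>G\<^esub> b) \<otimes>\<^bsub>K\<^esub> \<phi> v"
          unfolding Cons \<phi>_Cons as using a by (simp add: e_def x Inl)
        show ?thesis
        proof (cases "a \<otimes>\<^bsub>G\<^esub> b = \<one>\<^bsub>G\<^esub>")
          case True
          then show ?thesis unfolding E using v by (simp only: True f.hom_one) (simp add: x Inl Cons True)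
        next
          case False
          then show ?thesis unfolding E by (simp add: x Inl Cons \<phi>_Cons e_def del: f.hom_mult)
        qed
      next
        case (Inr b)
        then show ?thesis using x a e1 Cons \<phi>_Cons by (auto simp: e_def)
      qed
    next
      case x: (Inr a)
      then have a: "a \<in> carrier H" using that by auto
      show ?thesis
      proof (cases y)
        case (Inr b)
        then have "b \<in> carrier H" using y by auto
        then have E: "e x \<otimes>\<^bsub>K\<^esub> \<phi> w = h (a \<otimes>\<^bsub>H\<^esub> b) \<otimes>\<^bsub>K\<^esub> \<phi> v"
          unfolding Cons \<phi>_Cons as using a by (simp add: e_def x Inr)
        show ?thesis
        proof (cases "a \<otimes>\<^bsub>H\<^esub> b = \<one>\<^bsub>H\<^esub>")
          case True
          then show ?thesis unfolding E using v by (simp only: True h.hom_one) (simp add: x Inr Cons True)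
        next
          case False
          then show ?thesis unfolding E by (simp add: x Inr Cons \<phi>_Cons e_def del: h.hom_mult)
        qed
      next
        case (Inl b)
        then show ?thesis using x a e1 Cons \<phi>_Cons by (auto simp: e_def)
      qed
    qed
  qed
  have fold: "\<phi> (foldr (fp_cons G H) u w) = \<phi> u \<otimes>\<^bsub>K\<^esub> \<phi> w"
    if "set u \<subseteq> letters" "w \<in> fp_words G H" for u w
    using that(1)
  proof (induction u)
    case Nil
    then show ?case using \<phi>[OF fp_words_letters[OF that(2)]] by (simp add: \<phi>_def)
  next
    case (Cons x u)
    have "set (foldr (fp_cons G H) u w) \<subseteq> letters"
      using foldr_closed[of u w] that Cons.prems by (intro fp_words_letters) auto
    then show ?case
      using Cons cons[of x "foldr (fp_cons G H) u w"] \<phi>_Cons e[of x] \<phi>[of u]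
        \<phi>[OF fp_words_letters[OF that(2)]] by (simp add: K.m_assoc)
  qed
  have hom: "\<phi> \<in> hom ?P K"
  proof (rule homI)
    show "\<phi> u \<in> carrier K" if "u \<in> carrier ?P" for u
      using that \<phi>[OF fp_words_letters] by (simp add: free_product_def)
    show "\<phi> (u \<otimes>\<^bsub>?P\<^esub> w) = \<phi> u \<otimes>\<^bsub>K\<^esub> \<phi> w" if "u \<in> carrier ?P" "w \<in> carrier ?P" for u w
      using that fold[OF fp_words_letters] by (simp add: free_product_def)
  qed
  have 1: "\<phi> (fp_inl G H a) = f a" if "a \<in> carrier G" for a
    using that cons[of "Inl a" "[]"] by (simp add: fp_inl_def \<phi>_def e_def)
  have 2: "\<phi> (fp_inr G H b) = h b" if "b \<in> carrier H" for b
    using that cons[of "Inr b" "[]"] by (simp add: fp_inr_def \<phi>_def e_def)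
  have "\<psi> w = \<phi> w"
    if psi: "\<psi> \<in> hom ?P K" "\<forall>a \<in> carrier G. \<psi> (fp_inl G H a) = f a"
      "\<forall>b \<in> carrier H. \<psi> (fp_inr G H b) = h b" and w: "w \<in> fp_words G H" for \<psi> w
    using w
  proof (induction w)
    case Nil
    interpret psi: group_hom ?P K \<psi>
      using psi(1) group_free_product K by (simp add: group_hom_def group_hom_axioms_def)
    show ?case using psi.hom_one by (simp add: free_product_def \<phi>_def)
  next
    case (Cons x w)
    let ?x = "case x of Inl a \<Rightarrow> fp_inl G H a | Inr b \<Rightarrow> fp_inr G H b"
    have x: "x \<in> letters" using Cons.prems by (auto simp: fp_words_def)
    have w: "w \<in> carrier ?P" using fp_words_Cons[OF Cons.prems] by (simp add: free_product_def)
    have xc: "?x \<in> carrier ?P" using x fp_inl_hom fp_inr_hom by (auto simp: hom_def)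
    have "\<psi> (x # w) = \<psi> (?x \<otimes>\<^bsub>?P\<^esub> w)" using fp_cons_mult[OF Cons.prems] by simp
    also have "\<dots> = \<psi> ?x \<otimes>\<^bsub>K\<^esub> \<psi> w" using hom_mult[OF psi(1) xc w] .
    also have "\<psi> ?x = e x" using psi x by (auto simp: e_def)
    finally show ?case using Cons.IH fp_words_Cons[OF Cons.prems] \<phi>_Cons by simp
  qed
  then show ?thesis
    using 1 2 by (intro bexI[OF _ hom] conjI ballI impI) (simp_all add: free_product_def)
qed

end

end

theory Submission
  imports Defs "HOL-Library.Sublist"
begin

text \<open>
  The cutsize balances the number of vertices, but both a change of generators and the tree
  structure of the free product produce weighted graphs. The key fact is therefore: if every induced
  subgraph of a finite graph has cutsize at most \<open>z\<close>, then for any vertex weights a set of at most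
  \<open>16 z\<close> vertices leaves only components of at most half the total weight.
  Suppose not. Then every set of at most \<open>16 z\<close> vertices leaves a unique heavy component. Applying
  the cutsize bound to heavy components shows that the smallest heavy component at least halves when
  \<open>z\<close> further vertices may be deleted, so the smallest one \<open>P\<close> for \<open>8 z\<close> vertices is much smaller
  than any heavy component for \<open>4 z\<close> vertices. Hence \<open>P\<close> can be enlarged to a much larger \<open>H\<close> in
  which \<open>k\<close> vertices separate few vertices, in proportion to \<open>k\<close>, from the heavy component;
  a maximal such \<open>H\<close> is as large as needed because the vertex boundary is submodular. But such an
  \<open>H\<close> has cutsize greater than \<open>z\<close>.

  In the Cayley graph of \<open>G * H\<close> for the union of the generators, take a longest word \<open>u\<close> that is a
  prefix of more than half of the vertices of a finite subgraph. The vertices \<open>u x\<close> with \<open>x\<close> a letter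
  form a subgraph of a copy of a Cayley graph of \<open>G\<close> and one of \<open>H\<close>; weight each by the number of
  vertices below it. Weighted separators of the two, together with \<open>u\<close>, separate the whole graph.
  Changing generators, and embedding \<open>G\<close> and \<open>H\<close>, thickens a subgraph by a bounded amount; a
  separator for the thickening weighted by the original vertices pulls back.
\<close>

section \<open>Components and cuts\<close>

definition induced :: "('a \<times> 'a) set \<Rightarrow> 'a set \<Rightarrow> 'a ugraph" where
  "induced E W = (W, E \<inter> W \<times> W)"

text \<open>The component of \<open>v\<close> in the subgraph induced on \<open>W\<close>, so that
  deleting vertices just shrinks \<open>W\<close>. It is empty when \<open>v\<close> is outside
  \<open>W\<close>.\<close>

definition comp_of :: "('a \<times> 'a) set \<Rightarrow> 'a set \<Rightarrow> 'a \<Rightarrow> 'a set" where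
  "comp_of E W v = {u \<in> W. (v, u) \<in> (E \<inter> W \<times> W)\<^sup>*}"

lemma separates_iff:
  "separates X Z \<longleftrightarrow> Z \<subseteq> verts X \<and>
     (\<forall>v \<in> verts X - Z. 2 * card (comp_of (edges X) (verts X - Z) v) \<le> card (verts X))"
  by (auto simp: separates_def components_def delete_verts_def comp_of_def)

lemma separates_induced_iff:
  "separates (induced E H) Z \<longleftrightarrow> Z \<subseteq> H \<and>
     (\<forall>v \<in> H - Z. 2 * card (comp_of E (H - Z) v) \<le> card H)"
proof -
  have "E \<inter> H \<times> H \<inter> (H - Z) \<times> (H - Z) = E \<inter> (H - Z) \<times> (H - Z)" by auto
  then show ?thesis by (simp add: separates_iff induced_def comp_of_def)
qed

lemma comp_of_subset: "comp_of E W v \<subseteq> W"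
  by (auto simp: comp_of_def)

lemma comp_of_self: "v \<in> W \<Longrightarrow> v \<in> comp_of E W v"
  by (auto simp: comp_of_def)

lemma comp_of_step:
  assumes "u \<in> comp_of E W v" "(u, x) \<in> E" "x \<in> W"
  shows "x \<in> comp_of E W v"
proof -
  have "(u, x) \<in> E \<inter> W \<times> W" "(v, u) \<in> (E \<inter> W \<times> W)\<^sup>*" using assms by (auto simp: comp_of_def)
  then show ?thesis using assms(3) unfolding comp_of_def by (auto intro: rtrancl_into_rtrancl)
qed

text \<open>Induction along a path from \<open>v\<close>. The step may also use that
  \<open>y\<close> is in the component, which supplies its membership in \<open>W\<close>.\<close>

lemma comp_of_subset_closed:
  assumes "v \<in> Q"
    and step: "\<And>y x. y \<in> Q \<Longrightarrow> y \<in> comp_of E W v \<Longrightarrow> (y, x) \<in> E \<Longrightarrow> x \<in> W \<Longrightarrow> x \<in> Q"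
  shows "comp_of E W v \<subseteq> Q"
proof
  fix u assume "u \<in> comp_of E W v"
  then have "(v, u) \<in> (E \<inter> W \<times> W)\<^sup>*" by (simp add: comp_of_def)
  then show "u \<in> Q"
  proof (induction rule: rtrancl_induct)
    case base show ?case by fact
  next
    case (step y x)
    then show ?case using assms(2)[of y x] by (auto simp: comp_of_def)
  qed
qed

lemma comp_of_mono: "W \<subseteq> W' \<Longrightarrow> comp_of E W v \<subseteq> comp_of E W' v"
  unfolding comp_of_def using rtrancl_mono[of "E \<inter> W \<times> W" "E \<inter> W' \<times> W'"] by blast

lemma comp_of_eq:
  assumes "sym E" "u \<in> comp_of E W v" "v \<in> W"
  shows "comp_of E W u = comp_of E W v"
proof -
  have "sym ((E \<inter> W \<times> W)\<^sup>*)" using assms(1) by (intro sym_rtrancl) (auto simp: sym_def)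
  then show ?thesis using assms unfolding comp_of_def by (auto simp: sym_def intro: rtrancl_trans)
qed

text \<open>A path from \<open>v\<close> in \<open>W\<close> never leaves its component, so it is
  also a path in \<open>W'\<close>.\<close>

lemma comp_of_subset_comp_of:
  assumes "comp_of E W v \<subseteq> W'" "v \<in> W"
  shows "comp_of E W v \<subseteq> comp_of E W' v"
proof (rule comp_of_subset_closed)
  show "v \<in> comp_of E W' v" using comp_of_self[OF subsetD[OF assms(1) comp_of_self[OF assms(2)]]] .
  fix y x assume "y \<in> comp_of E W' v" "y \<in> comp_of E W v" "(y, x) \<in> E" "x \<in> W"
  then show "x \<in> comp_of E W' v" using assms(1) comp_of_step[of y E W v x] comp_of_step[of y E W' v x] by auto
qed

lemma finite_separator:
  assumes "finite (verts X)"
  shows "\<exists>Z. separates X Z \<and> card Z = cut X"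
  using Min_in[OF finite_cut_set[OF assms]] separates_verts[of X]
  unfolding cut_def by fastforce

lemma cut_le: "finite (verts X) \<Longrightarrow> separates X Z \<Longrightarrow> cut X \<le> card Z"
  unfolding cut_def by (rule Min_le[OF finite_cut_set]) auto

section \<open>Weighted separators\<close>

definition bd :: "('a \<times> 'a) set \<Rightarrow> 'a set \<Rightarrow> 'a set \<Rightarrow> 'a set" where
  "bd E H C = {v \<in> H - C. \<exists>c \<in> C. (c, v) \<in> E}"

text \<open>A vertex in one of the boundaries on the left is in one on the right, and a vertex in
  both on the left is in both on the right.\<close>

lemma card_bd_submodular:
  assumes "finite H"
  shows "card (bd E H (C \<inter> D)) + card (bd E H (C \<union> D)) \<le> card (bd E H C) + card (bd E H D)"
proof -
  let ?i = "bd E H (C \<inter> D)" and ?u = "bd E H (C \<union> D)" and ?c = "bd E H C" and ?d = "bd E H D"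
  have f: "finite ?i" "finite ?u" "finite ?c" "finite ?d" using assms by (auto simp: bd_def)
  have "card (?i \<union> ?u) \<le> card (?c \<union> ?d)" "card (?i \<inter> ?u) \<le> card (?c \<inter> ?d)"
    using f by (auto intro!: card_mono simp: bd_def)
  then show ?thesis using card_Un_Int[OF f(1,2)] card_Un_Int[OF f(3,4)] by linarith
qed

lemma comp_of_subset_bd:
  assumes "v \<in> C" "comp_of E W v \<subseteq> H" "comp_of E W v \<inter> bd E H C = {}"
  shows "comp_of E W v \<subseteq> C"
proof (rule comp_of_subset_closed)
  show "v \<in> C" by fact
  fix y x assume "y \<in> C" "y \<in> comp_of E W v" "(y, x) \<in> E" "x \<in> W"
  then show "x \<in> C" using assms(2,3) comp_of_step[of y E W v x] by (auto simp: bd_def)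
qed

lemma bd_comp_of: "bd E H (comp_of E (H - Z) v) \<subseteq> Z"
  using comp_of_step by (fastforce simp: bd_def)

text \<open>The hypotheses of the weighted separator theorem with the negation of its conclusion,
  collected in order to be refuted.\<close>

locale no_weighted_separator =
  fixes V :: "'a set" and E :: "('a \<times> 'a) set" and w :: "'a \<Rightarrow> nat" and z :: nat
  assumes fin: "finite V" and sym: "sym E" and z: "z \<ge> 1"
    and cuts: "\<And>H. H \<subseteq> V \<Longrightarrow> cut (induced E H) \<le> z"
    and big: "\<And>Y. Y \<subseteq> V \<Longrightarrow> card Y \<le> 16 * z \<Longrightarrow>
      \<exists>v \<in> V - Y. sum w V < 2 * sum w (comp_of E (V - Y) v)"
begin

section \<open>Heavy components and the budget of deleted vertices\<close>

definition heavy_comp :: "nat \<Rightarrow> 'a set \<Rightarrow> bool" where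
  "heavy_comp k K \<longleftrightarrow> (\<exists>Y \<subseteq> V. card Y \<le> k \<and>
     (\<exists>v \<in> V - Y. K = comp_of E (V - Y) v \<and> sum w V < 2 * sum w K))"

lemma big_Int:
  assumes "sum w V < 2 * sum w A" "sum w V < 2 * sum w B" "A \<subseteq> V" "B \<subseteq> V"
  shows "A \<inter> B \<noteq> {}"
proof
  assume "A \<inter> B = {}"
  then have "sum w A + sum w B = sum w (A \<union> B)"
    using assms fin by (intro sum.union_disjoint[symmetric]) (auto dest: finite_subset)
  also have "\<dots> \<le> sum w V" using assms fin by (intro sum_mono2) auto
  finally show False using assms by linarith
qed

lemma big_mono: "sum w V < 2 * sum w A \<Longrightarrow> A \<subseteq> B \<Longrightarrow> B \<subseteq> V \<Longrightarrow> sum w V < 2 * sum w B"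
  using sum_mono2[of B A w] fin finite_subset[of B V] by fastforce

lemma heavy_comp_mono: "heavy_comp k K \<Longrightarrow> k \<le> l \<Longrightarrow> heavy_comp l K"
  unfolding heavy_comp_def using le_trans by blast

lemma heavy_comp_subset: "heavy_comp k K \<Longrightarrow> K \<subseteq> V"
  unfolding heavy_comp_def using comp_of_subset by fastforce

lemma separator_induced:
  assumes "H \<subseteq> V"
  obtains Z where "Z \<subseteq> H" "card Z \<le> z" "\<And>v. v \<in> H - Z \<Longrightarrow> 2 * card (comp_of E (H - Z) v) \<le> card H"
proof -
  have "finite H" using assms fin by (rule finite_subset)
  then have "finite (verts (induced E H))" by (simp add: induced_def)
  from finite_separator[OF this] cuts[OF assms] that show ?thesis
    by (auto simp: separates_induced_iff)
qed

text \<open>Some component left by \<open>Y \<union> Z\<close> is heavy by \<open>big\<close>. It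
  meets \<open>P\<close>, as any two sets of more than half the weight meet, and it is connected in
  \<open>V - Y\<close>, so it lies inside \<open>P\<close>.\<close>

lemma big_component_in:
  assumes "Y \<subseteq> V" "u \<in> V - Y" "P = comp_of E (V - Y) u" "sum w V < 2 * sum w P"
    and "Z \<subseteq> V" "card Y + card Z \<le> 16 * z"
  obtains v K where "v \<in> P - Z" "K = comp_of E (V - (Y \<union> Z)) v" "sum w V < 2 * sum w K"
    "K \<subseteq> P - Z" "v \<in> V - (Y \<union> Z)"
proof -
  have "card (Y \<union> Z) \<le> 16 * z" using assms(6) card_Un_le[of Y Z] by linarith
  then obtain v where v: "v \<in> V - (Y \<union> Z)" "sum w V < 2 * sum w (comp_of E (V - (Y \<union> Z)) v)"
    using big[of "Y \<union> Z"] assms by auto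
  let ?K = "comp_of E (V - (Y \<union> Z)) v"
  have KV: "?K \<subseteq> V - (Y \<union> Z)" by (rule comp_of_subset)
  have PV: "P \<subseteq> V" using assms(3) comp_of_subset[of E "V - Y" u] by auto
  obtain x where x: "x \<in> ?K" "x \<in> P" using big_Int[OF v(2) assms(4)] KV PV by blast
  have x': "x \<in> comp_of E (V - Y) v" using x(1) comp_of_mono[of "V - (Y \<union> Z)" "V - Y" E v] by auto
  have "comp_of E (V - Y) v = P"
    using comp_of_eq[OF sym x'] comp_of_eq[OF sym, of x "V - Y" u] x assms v by auto
  then have "?K \<subseteq> P" using comp_of_mono[of "V - (Y \<union> Z)" "V - Y" E v] by auto
  then show ?thesis using that[of v ?K] v KV comp_of_self[OF v(1)] by blast
qed

text \<open>Delete a separator \<open>Z\<close> of the graph induced on \<open>P\<close>. The heavy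
  component that remains lies in one component of \<open>P - Z\<close>, which has at most half of
  the vertices of \<open>P\<close>.\<close>

lemma heavy_comp_halve:
  assumes "heavy_comp k P" "k + z \<le> 16 * z"
  obtains K where "heavy_comp (k + z) K" "2 * card K \<le> card P"
proof -
  obtain Y u where Y: "Y \<subseteq> V" "card Y \<le> k" "u \<in> V - Y" "P = comp_of E (V - Y) u"
    "sum w V < 2 * sum w P" using assms(1) unfolding heavy_comp_def by blast
  have PV: "P \<subseteq> V" using heavy_comp_subset[OF assms(1)] .
  obtain Z where Z: "Z \<subseteq> P" "card Z \<le> z"
    "\<And>v. v \<in> P - Z \<Longrightarrow> 2 * card (comp_of E (P - Z) v) \<le> card P"
    using separator_induced[OF PV] by metis
  have ZV: "Z \<subseteq> V" using Z PV by auto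
  have c: "card Y + card Z \<le> 16 * z" using Y Z assms by auto
  obtain v K where K: "v \<in> P - Z" "K = comp_of E (V - (Y \<union> Z)) v" "sum w V < 2 * sum w K"
    "K \<subseteq> P - Z" "v \<in> V - (Y \<union> Z)"
    using big_component_in[OF Y(1,3,4,5) ZV c] by blast
  have "K \<subseteq> comp_of E (P - Z) v" using comp_of_subset_comp_of K by metis
  moreover have "finite (comp_of E (P - Z) v)"
    using comp_of_subset[of E "P - Z" v] PV fin by (meson Diff_subset finite_subset)
  ultimately have "card K \<le> card (comp_of E (P - Z) v)" by (intro card_mono)
  then have "2 * card K \<le> card P" using Z(3)[OF K(1)] by linarith
  moreover have "heavy_comp (k + z) K"
    unfolding heavy_comp_def using K Y Z ZV card_Un_le[of Y Z]
    by (intro exI[of _ "Y \<union> Z"]) auto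
  ultimately show ?thesis using that by blast
qed

text \<open>If \<open>C\<close> is the heavy component left by a separator \<open>Z\<close> of \<open>H\<close>, then its boundary lies in
  \<open>Z\<close>, so the inequality bounds the number of vertices that \<open>Z\<close> can cut off from \<open>C\<close>.
  The core \<open>P\<close> is kept inside \<open>H\<close> to carry the weight that singles out heavy components.\<close>

definition isoperimetric :: "'a set \<Rightarrow> nat \<Rightarrow> 'a set \<Rightarrow> bool" where
  "isoperimetric P N H \<longleftrightarrow> P \<subseteq> H \<and> H \<subseteq> V \<and>
     (\<forall>C \<subseteq> H. sum w V < 2 * sum w (C \<inter> P) \<longrightarrow> card (H - C - P) \<le> N * card (bd E H C))"

text \<open>Equality in the isoperimetric inequality: these sets are the obstructions to enlarging
  \<open>H\<close>.\<close>

definition tight :: "'a set \<Rightarrow> nat \<Rightarrow> 'a set \<Rightarrow> 'a set \<Rightarrow> bool" where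
  "tight P N H C \<longleftrightarrow> C \<subseteq> H \<and> sum w V < 2 * sum w (C \<inter> P) \<and>
     card (H - C - P) = N * card (bd E H C)"

text \<open>The left side of the inequality is modular and the right side submodular, so equality at
  \<open>C\<close> and \<open>D\<close> passes to \<open>C \<inter> D\<close>, provided that
  \<open>C \<inter> D\<close> and \<open>C \<union> D\<close> still contain more than half the
  weight within \<open>P\<close>.\<close>

lemma tight_Int:
  assumes P: "heavy_comp (8 * z) P" and H: "isoperimetric P N H" "card H \<le> N * (4 * z)" and N: "N \<ge> 1"
    and C: "tight P N H C" and D: "tight P N H D"
  shows "tight P N H (C \<inter> D)"
proof -
  have HV: "P \<subseteq> H" "H \<subseteq> V" using H by (auto simp: isoperimetric_def)
  have fH: "finite H" using HV fin by (auto dest: finite_subset)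
  \<comment> \<open>With \<open>8 * z\<close> vertices spent on \<open>P\<close>, deleting the
    boundaries of two tight sets then stays within \<open>16 * z\<close>.\<close>
  have small: "card (bd E H B) \<le> 4 * z" if "tight P N H B" for B
  proof -
    have "N * card (bd E H B) \<le> card H"
      using that fH by (metis tight_def card_mono Diff_subset order_trans)
    then show ?thesis using H(2) N by (metis mult_le_cancel1 order_trans not_one_le_zero neq0_conv)
  qed
  have CD: "C \<subseteq> H" "D \<subseteq> H" "sum w V < 2 * sum w (C \<inter> P)" "sum w V < 2 * sum w (D \<inter> P)"
    using C D by (auto simp: tight_def)
  obtain Y u where Y: "Y \<subseteq> V" "card Y \<le> 8 * z" "u \<in> V - Y" "P = comp_of E (V - Y) u"
    "sum w V < 2 * sum w P" using P unfolding heavy_comp_def by blast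
  let ?Z = "bd E H C \<union> bd E H D"
  have ZV: "?Z \<subseteq> V" using HV by (auto simp: bd_def)
  have c: "card Y + card ?Z \<le> 16 * z"
    using Y small[OF C] small[OF D] card_Un_le[of "bd E H C" "bd E H D"] by linarith
  obtain v K where K: "v \<in> P - ?Z" "K = comp_of E (V - (Y \<union> ?Z)) v" "sum w V < 2 * sum w K"
    "K \<subseteq> P - ?Z" "v \<in> V - (Y \<union> ?Z)"
    using big_component_in[OF Y(1,3,4,5) ZV c] by blast
  \<comment> \<open>\<open>K\<close> meets \<open>B\<close> by weight and avoids its boundary, so it
    cannot leave \<open>B\<close>.\<close>
  have KB: "K \<subseteq> B" if B: "bd E H B \<subseteq> ?Z" "B \<subseteq> H" "sum w V < 2 * sum w (B \<inter> P)" for B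
  proof -
    have "K \<inter> (B \<inter> P) \<noteq> {}" by (rule big_Int[OF K(3) B(3)]) (use K HV B in auto)
    then obtain x where x: "x \<in> K" "x \<in> B" by auto
    have eq: "comp_of E (V - (Y \<union> ?Z)) x = K" using comp_of_eq[OF sym _ K(5)] x K(2) by auto
    have "comp_of E (V - (Y \<union> ?Z)) x \<subseteq> B"
      by (rule comp_of_subset_bd[OF x(2), where H = H]) (use eq K HV B in auto)
    then show ?thesis using eq by simp
  qed
  have "K \<subseteq> C \<inter> D \<inter> P" using KB[of C] KB[of D] CD K by auto
  then have bI: "sum w V < 2 * sum w (C \<inter> D \<inter> P)"
    using big_mono[OF K(3)] CD HV by (metis inf.coboundedI2 inf_commute order_trans)
  have bU: "sum w V < 2 * sum w ((C \<union> D) \<inter> P)"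
    using big_mono[OF CD(3), of "(C \<union> D) \<inter> P"] HV by auto
  have 1: "card (H - (C \<inter> D) - P) \<le> N * card (bd E H (C \<inter> D))"
    "card (H - (C \<union> D) - P) \<le> N * card (bd E H (C \<union> D))"
    using H(1) bI bU CD unfolding isoperimetric_def by (simp_all add: le_infI1)
  have "(H - (C \<inter> D) - P) = (H - C - P) \<union> (H - D - P)"
    "(H - (C \<union> D) - P) = (H - C - P) \<inter> (H - D - P)" by auto
  then have 2: "card (H - C - P) + card (H - D - P) =
      card (H - (C \<inter> D) - P) + card (H - (C \<union> D) - P)"
    using fH card_Un_Int[of "H - C - P" "H - D - P"] by simp
  have "N * (card (bd E H (C \<inter> D)) + card (bd E H (C \<union> D))) \<le>
      N * (card (bd E H C) + card (bd E H D))"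
    using card_bd_submodular[OF fH] by (rule mult_le_mono2)
  then have "card (H - (C \<inter> D) - P) = N * card (bd E H (C \<inter> D))"
    using 1 2 C D unfolding tight_def by (simp add: distrib_left)
  then show ?thesis using bI CD by (auto simp: tight_def)
qed

text \<open>A vertex that cannot be added to \<open>H\<close> is blocked by a tight set to which it is not adjacent;
  as tight sets are closed under intersection, a smallest tight set then blocks all vertices at
  once, so that its boundary in \<open>H\<close> is already its boundary in \<open>V\<close>.\<close>

lemma isoperimetric_insert_or_tight:
  assumes H: "isoperimetric P N H" and N: "N \<ge> 1" and v: "v \<in> V - H"
    and ng: "\<not> isoperimetric P N (insert v H)"
  obtains C where "tight P N H C" "\<And>c. c \<in> C \<Longrightarrow> (c, v) \<notin> E"
proof -
  have HV: "P \<subseteq> H" "H \<subseteq> V" using H by (auto simp: isoperimetric_def)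
  have fH: "finite H" using HV fin by (auto dest: finite_subset)
  have le: "card (H - C - P) \<le> N * card (bd E H C)"
    if "C \<subseteq> H" "sum w V < 2 * sum w (C \<inter> P)" for C
    using H that by (auto simp: isoperimetric_def)
  obtain C where C: "C \<subseteq> insert v H" "sum w V < 2 * sum w (C \<inter> P)"
    "\<not> card (insert v H - C - P) \<le> N * card (bd E (insert v H) C)"
    using ng HV v unfolding isoperimetric_def by blast
  have vP: "v \<notin> P" using HV v by auto
  have fb: "finite (bd E (insert v H) C)" using fH by (simp add: bd_def)
  \<comment> \<open>If \<open>v\<close> were in \<open>C\<close>, removing it from \<open>C\<close>
    would keep the left side and not enlarge the boundary, so \<open>H\<close> would already violate
    the inequality.\<close>
  have vC: "v \<notin> C"
  proof
    assume vC: "v \<in> C"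
    have "(C - {v}) \<inter> P = C \<inter> P" using vP by auto
    then have "card (H - (C - {v}) - P) \<le> N * card (bd E H (C - {v}))"
      using le[of "C - {v}"] C by auto
    moreover have "H - (C - {v}) - P = insert v H - C - P" using vC v by auto
    moreover have "card (bd E H (C - {v})) \<le> card (bd E (insert v H) C)"
      using fb v by (intro card_mono) (auto simp: bd_def)
    ultimately show False using C(3) by (metis mult_le_mono2 order_trans)
  qed
  then have CH: "C \<subseteq> H" using C by auto
  \<comment> \<open>The left side grows by one. An edge from \<open>C\<close> to \<open>v\<close>
    would enlarge the boundary and pay for this, as \<open>N \<ge> 1\<close>; without one, a
    violation means equality before the insertion.\<close>
  have i: "card (insert v H - C - P) = Suc (card (H - C - P))"
    using vC vP v fH by (simp add: insert_Diff_if)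
  have nE: "(c, v) \<notin> E" if "c \<in> C" for c
  proof
    assume "(c, v) \<in> E"
    then have "bd E (insert v H) C = insert v (bd E H C)" using that vC by (auto simp: bd_def)
    moreover have "v \<notin> bd E H C" "finite (bd E H C)" using v fH by (auto simp: bd_def)
    ultimately have "card (bd E (insert v H) C) = Suc (card (bd E H C))" by simp
    then show False using C(3) i le[OF CH C(2)] N by simp
  qed
  have "bd E (insert v H) C = bd E H C" using nE by (auto simp: bd_def)
  then have "card (H - C - P) = N * card (bd E H C)" using C(3) i le[OF CH C(2)] by simp
  then show ?thesis using that[of C] CH C nE by (auto simp: tight_def)
qed

lemma inconsistent: False
proof -
  have "\<exists>K. heavy_comp (4 * z) K" using big[of "{}"] unfolding heavy_comp_def by fastforce
  then obtain A where A: "heavy_comp (4 * z) A" "\<And>K. heavy_comp (4 * z) K \<Longrightarrow> card A \<le> card K"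
    using ex_has_least_nat[of "heavy_comp (4 * z)" _ card] by blast
  \<comment> \<open>Otherwise \<open>A\<close> itself could be deleted within the budget, leaving no
    room for a heavy component inside it.\<close>
  have A_ge: "4 * z \<le> card A"
  proof (rule ccontr)
    assume "\<not> 4 * z \<le> card A"
    moreover obtain Y u where Y: "Y \<subseteq> V" "card Y \<le> 4 * z" "u \<in> V - Y" "A = comp_of E (V - Y) u"
      "sum w V < 2 * sum w A" using A(1) unfolding heavy_comp_def by blast
    ultimately have "card Y + card A \<le> 16 * z" by linarith
    from big_component_in[OF Y(1,3,4,5) heavy_comp_subset[OF A(1)] this] show False by blast
  qed
  \<comment> \<open>Four halvings raise the budget from \<open>4 * z\<close> to \<open>8 * z\<close>
    and divide the size by at least 16.\<close>
  obtain P1 where P1: "heavy_comp (4 * z + z) P1" "2 * card P1 \<le> card A"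
    using heavy_comp_halve[OF A(1)] by auto
  obtain P2 where P2: "heavy_comp (4 * z + z + z) P2" "2 * card P2 \<le> card P1"
    using heavy_comp_halve[OF P1(1)] by auto
  obtain P3 where P3: "heavy_comp (4 * z + z + z + z) P3" "2 * card P3 \<le> card P2"
    using heavy_comp_halve[OF P2(1)] by auto
  obtain P where P': "heavy_comp (4 * z + z + z + z + z) P" "2 * card P \<le> card P3"
    using heavy_comp_halve[OF P3(1)] by auto
  have P: "heavy_comp (8 * z) P" "16 * card P \<le> card A"
    using P' P1 P2 P3 by (auto intro: heavy_comp_mono)
  \<comment> \<open>The target size \<open>N * (4 * z)\<close> of \<open>H\<close> is at most
    \<open>card A\<close> and, as \<open>N \<ge> 1\<close>, more than half of it; hence it exceeds
    \<open>8 * card P\<close>.\<close>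
  define N where "N = card A div (4 * z)"
  have N: "N \<ge> 1" using A_ge z by (simp add: N_def div_greater_zero_iff Suc_le_eq)
  have NA: "N * (4 * z) \<le> card A" by (simp add: N_def)
  have "card A < 4 * z + N * (4 * z)"
    using dividend_less_div_times[of "4 * z" "card A"] z by (simp add: N_def)
  moreover have "1 * (4 * z) \<le> N * (4 * z)" using N by (rule mult_le_mono1)
  ultimately have PN: "8 * card P < N * (4 * z)" using P(2) by linarith
  have PV: "P \<subseteq> V" using heavy_comp_subset[OF P(1)] .
  have gP: "isoperimetric P N P" using PV by (auto simp: isoperimetric_def Diff_eq)
  obtain H where H: "isoperimetric P N H" "card H \<le> N * (4 * z)"
    and Hmax: "\<And>H'. isoperimetric P N H' \<Longrightarrow> card H' \<le> N * (4 * z) \<Longrightarrow> card H' \<le> card H"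
    using ex_has_greatest_nat[of "\<lambda>H. isoperimetric P N H \<and> card H \<le> N * (4 * z)" P card "Suc (N * (4 * z))"]
      gP PN by (auto simp: less_Suc_eq_le)
  have HV: "P \<subseteq> H" "H \<subseteq> V" using H by (auto simp: isoperimetric_def)
  have fH: "finite H" using HV fin by (auto dest: finite_subset)
  obtain Y u where Y: "Y \<subseteq> V" "card Y \<le> 8 * z" "u \<in> V - Y" "P = comp_of E (V - Y) u"
    "sum w V < 2 * sum w P" using P(1) unfolding heavy_comp_def by blast
  have cH: "card H = N * (4 * z)"
  proof (rule ccontr)
    assume "card H \<noteq> N * (4 * z)"
    then have lt: "card H < N * (4 * z)" using H by simp
    \<comment> \<open>Both sides vanish at \<open>H\<close> itself, so tight sets exist.\<close>
    have "tight P N H H" using HV Y(5) by (auto simp: tight_def bd_def Int_absorb1)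
    then obtain C where C: "tight P N H C" "\<And>D. tight P N H D \<Longrightarrow> card C \<le> card D"
      using ex_has_least_nat[of "tight P N H" H card] by blast
    have CH: "C \<subseteq> H" "sum w V < 2 * sum w (C \<inter> P)" using C by (auto simp: tight_def)
    have bdV: "bd E V C = bd E H C"
    proof -
      have "(c, v) \<notin> E" if v: "v \<in> V - H" and c: "c \<in> C" for c v
      proof -
        have "\<not> isoperimetric P N (insert v H)"
        proof
          assume "isoperimetric P N (insert v H)"
          moreover have "card (insert v H) = Suc (card H)" using v fH by simp
          ultimately show False using Hmax[of "insert v H"] lt by simp
        qed
        then obtain D where D: "tight P N H D" "\<And>c. c \<in> D \<Longrightarrow> (c, v) \<notin> E"
          using isoperimetric_insert_or_tight[OF H(1) N v] by blast
        \<comment> \<open>Minimality puts \<open>C\<close> inside every blocking set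
          \<open>D\<close>, so \<open>v\<close> is not adjacent to \<open>C\<close> either.\<close>
        have "card C \<le> card (C \<inter> D)" using C(2) tight_Int[OF P(1) H N C(1) D(1)] .
        then have "C \<inter> D = C"
          using CH fH by (intro card_seteq) (auto dest: finite_subset)
        then show ?thesis using D c by blast
      qed
      then show ?thesis using HV by (auto simp: bd_def)
    qed
    have "N * card (bd E H C) \<le> card H"
      using C(1) fH by (metis tight_def card_mono Diff_subset order_trans)
    then have c4: "card (bd E V C) \<le> 4 * z"
      using lt bdV N by (metis mult_less_cancel1 order_le_less_trans less_imp_le)
    have bV: "bd E V C \<subseteq> V" by (auto simp: bd_def)
    have cb: "card (bd E V C) \<le> 16 * z" using c4 by simp
    obtain v where v: "v \<in> V - bd E V C" "sum w V < 2 * sum w (comp_of E (V - bd E V C) v)"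
      using big[OF bV cb] by blast
    \<comment> \<open>This component meets \<open>C\<close> and avoids its boundary in
      \<open>V\<close>, so it lies in \<open>H\<close>: a heavy component for \<open>4 * z\<close>
      smaller than \<open>A\<close>.\<close>
    let ?K = "comp_of E (V - bd E V C) v"
    have KV: "?K \<subseteq> V - bd E V C" by (rule comp_of_subset)
    have "?K \<inter> (C \<inter> P) \<noteq> {}" by (rule big_Int[OF v(2) CH(2)]) (use KV PV in auto)
    then obtain x where x: "x \<in> ?K" "x \<in> C" by auto
    have eq: "comp_of E (V - bd E V C) x = ?K" using comp_of_eq[OF sym x(1) v(1)] .
    have "comp_of E (V - bd E V C) x \<subseteq> C"
      by (rule comp_of_subset_bd[OF x(2), where H = V]) (use eq KV in auto)
    then have "card ?K \<le> card H" using eq CH fH by (intro card_mono) auto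
    moreover have "heavy_comp (4 * z) ?K" unfolding heavy_comp_def using bV c4 v by blast
    ultimately show False using A(2) NA lt by fastforce
  qed
  obtain Z where Z: "Z \<subseteq> H" "card Z \<le> z"
    "\<And>v. v \<in> H - Z \<Longrightarrow> 2 * card (comp_of E (H - Z) v) \<le> card H"
    using separator_induced[OF HV(2)] by metis
  have ZV: "Z \<subseteq> V" using Z HV by auto
  have c: "card Y + card Z \<le> 16 * z" using Y Z by auto
  obtain v K where K: "v \<in> P - Z" "K = comp_of E (V - (Y \<union> Z)) v" "sum w V < 2 * sum w K"
    "K \<subseteq> P - Z" "v \<in> V - (Y \<union> Z)"
    using big_component_in[OF Y(1,3,4,5) ZV c] by blast
  let ?C = "comp_of E (H - Z) v"
  have CH: "?C \<subseteq> H" using comp_of_subset[of E "H - Z" v] by auto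
  have "K \<subseteq> ?C" using comp_of_subset_comp_of[of E "V - (Y \<union> Z)" v "H - Z"] K HV by auto
  then have bC: "sum w V < 2 * sum w (?C \<inter> P)"
    using big_mono[OF K(3), of "?C \<inter> P"] K PV by auto
  have "card (bd E H ?C) \<le> card Z"
    using bd_comp_of Z fH by (metis card_mono finite_subset)
  then have "N * card (bd E H ?C) \<le> N * z" using Z by (meson mult_le_mono2 order_trans)
  moreover have "card (H - ?C - P) \<le> N * card (bd E H ?C)"
    using H(1) CH bC unfolding isoperimetric_def by blast
  ultimately have "card (H - ?C - P) \<le> N * z" by linarith
  moreover have "card (H - ?C) \<le> card (H - ?C - P) + card P"
  proof -
    have "finite ((H - ?C - P) \<union> P)" using fH HV finite_subset by auto
    then have "card (H - ?C) \<le> card ((H - ?C - P) \<union> P)" by (rule card_mono) auto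
    then show ?thesis using card_Un_le[of "H - ?C - P" P] by linarith
  qed
  moreover have "card H = card (H - ?C) + card ?C"
    using card_Diff_subset[OF finite_subset[OF CH fH] CH] card_mono[OF fH CH] by simp
  moreover have "2 * card ?C \<le> card H" using Z(3) K HV by auto
  \<comment> \<open>At most \<open>N * z + card P\<close> vertices of \<open>H\<close> lie outside
    \<open>?C\<close> and at most half of \<open>4 * N * z\<close> inside, so
    \<open>N * z \<le> card P\<close>, against \<open>PN\<close>.\<close>
  ultimately show False using cH PN by (simp add: algebra_simps)
qed

end

theorem weighted_separator:
  fixes w :: "'a \<Rightarrow> nat"
  assumes "finite V" "sym E" "z \<ge> 1" "\<And>H. H \<subseteq> V \<Longrightarrow> cut (induced E H) \<le> z"
  obtains Y where "Y \<subseteq> V" "card Y \<le> 16 * z"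
    "\<And>v. v \<in> V - Y \<Longrightarrow> 2 * sum w (comp_of E (V - Y) v) \<le> sum w V"
proof -
  have "\<not> no_weighted_separator V E w z" using no_weighted_separator.inconsistent by blast
  then show ?thesis using assms that unfolding no_weighted_separator_def by (meson leI)
qed

section \<open>Separation profiles\<close>

lemma ugraph_subgraph_induced:
  assumes "ugraph X" "W \<subseteq> verts X"
  shows "ugraph_subgraph (induced (edges X) W) X"
  using assms unfolding ugraph_subgraph_def ugraph_def induced_def sym_def irrefl_def by auto

lemma cut_le_sep:
  "ugraph_subgraph Y X \<Longrightarrow> finite (verts Y) \<Longrightarrow> card (verts Y) \<le> r \<Longrightarrow> cut Y \<le> sep X r"
  unfolding sep_def by (rule Max_ge[OF sep_set_finite_nonempty(1)]) blast

lemma sep_leI: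
  assumes "\<And>Y. ugraph_subgraph Y X \<Longrightarrow> finite (verts Y) \<Longrightarrow> card (verts Y) \<le> r \<Longrightarrow> cut Y \<le> b"
  shows "sep X r \<le> b"
  unfolding sep_def using sep_set_finite_nonempty[of X r] assms by (subst Max_le_iff) auto

lemma mono_sep: "mono (sep X)"
  by (rule monoI) (auto intro!: sep_leI cut_le_sep)

text \<open>A separator of the image pulls back: \<open>f\<close> sends each remaining component
  into one of the image, and injectivity keeps the cardinalities comparable.\<close>

lemma cut_le_cut_induced_image:
  assumes fin: "finite (verts X)" and inj: "inj_on f (verts X)"
    and edge: "\<And>x y. x \<in> verts X \<Longrightarrow> y \<in> verts X \<Longrightarrow> (x, y) \<in> edges X \<Longrightarrow> (f x, f y) \<in> E"
  shows "cut X \<le> cut (induced E (f ` verts X))"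
proof -
  let ?V = "verts X" and ?I = "induced E (f ` verts X)"
  have "finite (verts ?I)" using fin by (simp add: induced_def)
  then obtain S where S: "separates ?I S" "card S = cut ?I"
    using finite_separator by blast
  define Z where "Z = {v \<in> ?V. f v \<in> S}"
  have SV: "S \<subseteq> f ` ?V" using S by (simp add: separates_induced_iff)
  have "separates X Z"
    unfolding separates_iff
  proof (intro conjI ballI)
    show "Z \<subseteq> ?V" by (auto simp: Z_def)
    fix v assume v: "v \<in> ?V - Z"
    let ?C = "comp_of (edges X) (?V - Z) v" and ?D = "comp_of E (f ` ?V - S) (f v)"
    have fv: "f v \<in> f ` ?V - S" using v by (auto simp: Z_def)
    have "?C \<subseteq> {u. f u \<in> ?D}"
    proof (rule comp_of_subset_closed)
      show "v \<in> {u. f u \<in> ?D}" using comp_of_self[OF fv] by simp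
      fix y x assume yx: "y \<in> {u. f u \<in> ?D}" "y \<in> ?C" "(y, x) \<in> edges X" "x \<in> ?V - Z"
      then have "(f y, f x) \<in> E" using edge comp_of_subset[of "edges X" "?V - Z" v] by auto
      moreover have "f x \<in> f ` ?V - S" using yx(4) by (auto simp: Z_def)
      ultimately show "x \<in> {u. f u \<in> ?D}" using yx(1) comp_of_step by fastforce
    qed
    then have "f ` ?C \<subseteq> ?D" by auto
    moreover have "finite ?D" using comp_of_subset[of E] fin by (meson finite_Diff finite_imageI finite_subset)
    moreover have "inj_on f ?C" using inj comp_of_subset[of "edges X" "?V - Z" v] by (meson Diff_subset inj_on_subset)
    ultimately have "card ?C \<le> card ?D" by (metis card_image card_mono)
    moreover have "2 * card ?D \<le> card (f ` ?V)" using S(1) fv by (simp add: separates_induced_iff)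
    ultimately show "2 * card ?C \<le> card ?V" using card_image_le[OF fin, of f] by linarith
  qed
  then have "cut X \<le> card Z" by (rule cut_le[OF fin])
  also have "card Z \<le> card S"
    using inj SV fin by (intro card_inj_on_le[of f]) (auto simp: Z_def inj_on_def intro: finite_subset)
  finally show ?thesis using S by simp
qed

lemma cut_le_sep_image:
  assumes "ugraph X" "finite (verts Y)" "card (verts Y) \<le> r" "inj_on f (verts Y)"
    and "f ` verts Y \<subseteq> verts X"
    and "\<And>x y. x \<in> verts Y \<Longrightarrow> y \<in> verts Y \<Longrightarrow> (x, y) \<in> edges Y \<Longrightarrow> (f x, f y) \<in> edges X"
  shows "cut Y \<le> sep X r"
proof -
  have "cut Y \<le> cut (induced (edges X) (f ` verts Y))"
    using assms by (intro cut_le_cut_induced_image)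
  also have "\<dots> \<le> sep X r"
  proof (rule cut_le_sep[OF ugraph_subgraph_induced[OF assms(1,5)]])
    show "card (verts (induced (edges X) (f ` verts Y))) \<le> r"
      using assms(3) card_image_le[OF assms(2), of f] by (simp add: induced_def)
  qed (use assms(2) in \<open>simp add: induced_def\<close>)
  finally show ?thesis .
qed

text \<open>Every subset of \<open>A\<close> induces a graph that embeds in \<open>X\<close> with at
  most \<open>r\<close> vertices, so \<open>z\<close> bounds all cutsizes. An upper bound
  \<open>z \<ge> 1\<close> lets one \<open>z\<close> serve two graphs and allows a vanishing
  profile.\<close>

lemma weighted_separator_sep:
  fixes w :: "'a \<Rightarrow> nat"
  assumes X: "ugraph X" and A: "finite A" "card A \<le> r" "sym E" and f: "inj_on f A" "f ` A \<subseteq> verts X"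
    and edge: "\<And>x y. x \<in> A \<Longrightarrow> y \<in> A \<Longrightarrow> (x, y) \<in> E \<Longrightarrow> (f x, f y) \<in> edges X"
    and z: "z \<ge> 1" "sep X r \<le> z"
  obtains Y where "Y \<subseteq> A" "card Y \<le> 16 * z"
    "\<And>v. v \<in> A - Y \<Longrightarrow> 2 * sum w (comp_of E (A - Y) v) \<le> sum w A"
proof -
  have "cut (induced E B) \<le> z" if B: "B \<subseteq> A" for B
  proof -
    have "cut (induced E B) \<le> sep X r"
    proof (rule cut_le_sep_image[OF X])
      show "card (verts (induced E B)) \<le> r"
        using card_mono[OF A(1) B] A(2) by (simp add: induced_def)
      show "inj_on f (verts (induced E B))" using inj_on_subset[OF f(1) B] by (simp add: induced_def)
      show "finite (verts (induced E B))" using finite_subset[OF B A(1)] by (simp add: induced_def)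
      show "f ` verts (induced E B) \<subseteq> verts X" using B f(2) by (auto simp: induced_def)
      show "(f x, f y) \<in> edges X" if "(x, y) \<in> edges (induced E B)" for x y
        using that B edge[of x y] by (auto simp: induced_def)
    qed
    then show ?thesis using z by linarith
  qed
  from weighted_separator[OF A(1,3) z(1) this] that show ?thesis by blast
qed

section \<open>Calculus of the asymptotic comparison\<close>

lemma asymp_le_trans:
  assumes "f \<lesssim>\<^sub>s g" "g \<lesssim>\<^sub>s h" "mono h"
  shows "f \<lesssim>\<^sub>s h"
proof -
  obtain C where C: "\<And>r. f r \<le> C * g (C * r) + C" using assms(1) unfolding asymp_le_def by blast
  obtain D where D: "\<And>r. g r \<le> D * h (D * r) + D" using assms(2) unfolding asymp_le_def by blast
  \<comment> \<open>This is the additive constant that results; as \<open>h\<close> is monotone, it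
    also serves as multiplier and as scale.\<close>
  let ?K = "C * D + C"
  have "f r \<le> ?K * h (?K * r) + ?K" for r
  proof -
    have "C * g (C * r) \<le> C * (D * h (D * (C * r)) + D)" using D by (rule mult_le_mono2)
    moreover have "D * (C * r) \<le> ?K * r" by (simp add: algebra_simps)
    then have "h (D * (C * r)) \<le> h (?K * r)" using assms(3) by (simp add: mono_def)
    then have "C * D * h (D * (C * r)) \<le> ?K * h (?K * r)" by (intro mult_le_mono) auto
    ultimately show ?thesis using C[of r] by (simp add: algebra_simps)
  qed
  then show ?thesis unfolding asymp_le_def by blast
qed

lemma asymp_le_max:
  assumes "f \<lesssim>\<^sub>s h" "g \<lesssim>\<^sub>s h" "mono h"
  shows "(\<lambda>r. max (f r) (g r)) \<lesssim>\<^sub>s h"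
proof -
  obtain C where C: "\<And>r. f r \<le> C * h (C * r) + C" using assms(1) unfolding asymp_le_def by blast
  obtain D where D: "\<And>r. g r \<le> D * h (D * r) + D" using assms(2) unfolding asymp_le_def by blast
  let ?K = "C + D"
  have "B * h (B * r) + B \<le> ?K * h (?K * r) + ?K" if "B \<le> ?K" for B r
    using that assms(3) by (intro add_mono mult_le_mono) (auto simp: mono_def)
  then have "f r \<le> ?K * h (?K * r) + ?K" "g r \<le> ?K * h (?K * r) + ?K" for r
    using C D by (meson le_add1 le_add2 le_trans)+
  then have "max (f r) (g r) \<le> ?K * h (?K * r) + ?K" for r by simp
  then show ?thesis unfolding asymp_le_def by blast
qed

lemma mono_max: "mono f \<Longrightarrow> mono g \<Longrightarrow> mono (\<lambda>r. max (f r) (g r :: nat))"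
  by (auto simp: mono_def intro: max.coboundedI1 max.coboundedI2)

section \<open>Change of generators\<close>

context group
begin

text \<open>Edges are right multiplications, so left multiplication by \<open>g\<close> is an
  automorphism of the Cayley graph.\<close>

lemma comp_of_cayley_translate:
  assumes g: "g \<in> carrier G" and u: "u \<in> comp_of (edges (cayley_graph G U)) B a"
    and B: "B \<subseteq> carrier G" and a: "a \<in> B" and U: "U \<subseteq> carrier G"
  shows "g \<otimes> u \<in> comp_of (edges (cayley_graph G U)) ((\<otimes>) g ` B) (g \<otimes> a)"
    (is "_ \<in> comp_of ?E _ _")
proof -
  have "comp_of ?E B a \<subseteq> {u. g \<otimes> u \<in> comp_of ?E ((\<otimes>) g ` B) (g \<otimes> a)}"
  proof (rule comp_of_subset_closed)
    show "a \<in> {u. g \<otimes> u \<in> comp_of ?E ((\<otimes>) g ` B) (g \<otimes> a)}"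
      using a by (auto intro: comp_of_self)
    fix y x assume *: "y \<in> {u. g \<otimes> u \<in> comp_of ?E ((\<otimes>) g ` B) (g \<otimes> a)}" "y \<in> comp_of ?E B a"
      "(y, x) \<in> ?E" "x \<in> B"
    have yx: "y \<in> carrier G" "x \<in> carrier G" using *(2-4) B comp_of_subset[of ?E B a] by auto
    have "(g \<otimes> y, g \<otimes> x) \<in> ?E"
      using *(3) g U yx unfolding cayley_graph_def
      by (auto simp: m_assoc subset_iff)
    then show "x \<in> {u. g \<otimes> u \<in> comp_of ?E ((\<otimes>) g ` B) (g \<otimes> a)}"
      using *(1,4) comp_of_step by fastforce
  qed
  then show ?thesis using u by auto
qed

lemma finite_path_set:
  assumes U: "U \<subseteq> carrier G" and t: "t \<in> generate G U"
  shows "\<exists>B. finite B \<and> B \<subseteq> carrier G \<and> \<one> \<in> B \<and> t \<in> comp_of (edges (cayley_graph G U)) B \<one>"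
    (is "\<exists>B. ?p B t")
  using t
proof (induction rule: generate.induct)
  case one
  show ?case by (rule exI[of _ "{\<one>}"]) (auto intro: comp_of_self)
next
  case (incl h)
  let ?E = "edges (cayley_graph G U)"
  have "h \<in> comp_of ?E {\<one>, h} \<one>"
  proof (cases "h = \<one>")
    case False
    then have "(\<one>, h) \<in> ?E" using incl U by (force simp: cayley_graph_def)
    then show ?thesis using comp_of_step[OF comp_of_self[of "\<one>" "{\<one>, h}" ?E]] by simp
  qed (auto intro: comp_of_self)
  then show ?case using incl U by (intro exI[of _ "{\<one>, h}"]) auto
next
  case (inv h)
  let ?E = "edges (cayley_graph G U)"
  have "inv h \<in> comp_of ?E {\<one>, inv h} \<one>"
  proof (cases "inv h = \<one>")
    case False
    have hc: "h \<in> carrier G" using inv U by auto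
    then have "\<exists>s\<in>U. \<one> = inv h \<otimes> s" using inv by (intro bexI[of _ h]) auto
    moreover have "\<one> \<noteq> inv h" using False by metis
    ultimately have "(\<one>, inv h) \<in> ?E"
      using inv_closed[OF hc] one_closed unfolding cayley_graph_def snd_conv mem_Collect_eq prod.case by blast
    then show ?thesis using comp_of_step[OF comp_of_self[of "\<one>" "{\<one>, inv h}" ?E]] by simp
  qed (auto intro: comp_of_self)
  then show ?case using inv U by (intro exI[of _ "{\<one>, inv h}"]) auto
next
  case (eng h1 h2)
  let ?E = "edges (cayley_graph G U)"
  have sE: "sym ?E" using ugraph_cayley_graph[of G U] by (simp add: ugraph_def)
  obtain B1 where B1: "?p B1 h1" using eng by blast
  obtain B2 where B2: "?p B2 h2" using eng by blast
  have h1: "h1 \<in> carrier G" using eng(1) generate_incl[OF U] by auto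
  \<comment> \<open>The path to \<open>h1\<close> is continued by the path to \<open>h2\<close>
    translated by \<open>h1\<close>.\<close>
  let ?B = "B1 \<union> (\<otimes>) h1 ` B2"
  have "h1 \<in> comp_of ?E ?B \<one>" using B1 comp_of_mono[of B1 ?B ?E \<one>] by auto
  then have eq: "comp_of ?E ?B h1 = comp_of ?E ?B \<one>" using B1 by (intro comp_of_eq[OF sE]) auto
  have "h1 \<otimes> h2 \<in> comp_of ?E ((\<otimes>) h1 ` B2) (h1 \<otimes> \<one>)"
    using B2 by (intro comp_of_cayley_translate h1 U) auto
  then have "h1 \<otimes> h2 \<in> comp_of ?E ?B h1"
    using h1 comp_of_mono[of "(\<otimes>) h1 ` B2" ?B ?E h1] by auto
  then show ?case using B1 B2 eq h1 by (intro exI[of _ ?B]) auto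
qed

text \<open>Right multiplication by an element of the finite set \<open>F\<close> is realised by
  translates of finitely many paths. This form covers both a change of generators and an injective
  homomorphism.\<close>

theorem sep_asymp_le_cayley:
  fixes X :: "'c ugraph"
  assumes U: "finite_generating_set G U"
    and f: "inj_on f (verts X)" "f ` verts X \<subseteq> carrier G"
    and F: "finite F" "F \<subseteq> carrier G"
    and edge: "\<And>x y. (x, y) \<in> edges X \<Longrightarrow> \<exists>t \<in> F. f y = f x \<otimes> t"
  shows "sep X \<lesssim>\<^sub>s sep (cayley_graph G U)"
proof -
  let ?K = "cayley_graph G U" and ?E = "edges (cayley_graph G U)"
  have UC: "U \<subseteq> carrier G" "generate G U = carrier G" using U by (auto simp: finite_generating_set_def)
  have uK: "ugraph ?K" by (rule ugraph_cayley_graph)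
  then have sE: "sym ?E" by (simp add: ugraph_def)
  have "\<forall>t \<in> F. \<exists>B. finite B \<and> B \<subseteq> carrier G \<and> \<one> \<in> B \<and> t \<in> comp_of ?E B \<one>"
    using finite_path_set[OF UC(1)] F UC(2) by auto
  then obtain b where b: "\<And>t. t \<in> F \<Longrightarrow> finite (b t) \<and> b t \<subseteq> carrier G \<and> \<one> \<in> b t \<and> t \<in> comp_of ?E (b t) \<one>"
    by metis
  \<comment> \<open>Inserting \<open>\<one>\<close> keeps the image of \<open>f\<close> inside the
    thickening even when \<open>F\<close> is empty.\<close>
  define B where "B = insert \<one> (\<Union>t\<in>F. b t)"
  have B: "finite B" "B \<subseteq> carrier G" "\<one> \<in> B" "\<And>t. t \<in> F \<Longrightarrow> b t \<subseteq> B"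
    using b F by (auto simp: B_def)
  have main: "cut Y \<le> card B * (16 * max 1 (sep ?K (card B * r)))"
    if Y: "ugraph_subgraph Y X" "finite (verts Y)" "card (verts Y) \<le> r" for Y r
  proof -
    let ?V = "verts Y" and ?z = "max 1 (sep ?K (card B * r))"
    have VX: "?V \<subseteq> verts X" "edges Y \<subseteq> edges X" using Y by (auto simp: ugraph_subgraph_def)
    have fV: "inj_on f ?V" "f ` ?V \<subseteq> carrier G" using f VX inj_on_subset by blast+
    define W where "W = (\<lambda>(v, b). f v \<otimes> b) ` (?V \<times> B)"
    have W: "finite W" "W \<subseteq> carrier G" using Y B fV by (auto simp: W_def image_subset_iff subset_iff)
    have WI: "f v \<otimes> c \<in> W" if "v \<in> ?V" "c \<in> B" for v c using that by (auto simp: W_def)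
    have "card W \<le> card (?V \<times> B)" unfolding W_def using Y B by (intro card_image_le) auto
    also have "\<dots> \<le> card B * r" using Y(3) by (simp add: card_cartesian_product)
    finally have cW: "card W \<le> card B * r" .
    have fW: "f ` ?V \<subseteq> W"
    proof
      fix p assume "p \<in> f ` ?V"
      then obtain v where v: "v \<in> ?V" "p = f v" by auto
      then show "p \<in> W" using WI[OF v(1) B(3)] fV by auto
    qed
    \<comment> \<open>Only the original vertices have weight, so the added vertices of
      \<open>W\<close> do not distort the balance.\<close>
    define w where "w p = (if p \<in> f ` ?V then 1 else 0 :: nat)" for p
    have sw: "sum w A = card (A \<inter> f ` ?V)" if "A \<subseteq> W" for A
      using finite_subset[OF that W(1)] by (simp add: w_def sum.If_cases)
    obtain S where S: "S \<subseteq> W" "card S \<le> 16 * ?z"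
      "\<And>v. v \<in> W - S \<Longrightarrow> 2 * sum w (comp_of ?E (W - S) v) \<le> sum w W"
      by (rule weighted_separator_sep[OF uK W(1) cW sE, of id ?z w])
        (use W in \<open>auto simp: cayley_graph_def\<close>)
    \<comment> \<open>A surviving \<open>x\<close> has all its translates
      \<open>f x \<otimes> c\<close> in \<open>W - S\<close>, hence also the paths that replace its
      edges.\<close>
    define Z where "Z = {x \<in> ?V. \<exists>c \<in> B. f x \<otimes> c \<in> S}"
    have "separates Y Z"
      unfolding separates_iff
    proof (intro conjI ballI)
      show "Z \<subseteq> ?V" by (auto simp: Z_def)
      fix v assume v: "v \<in> ?V - Z"
      have inW: "f x \<otimes> c \<in> W - S" if "x \<in> ?V - Z" "c \<in> B" for x c
        using that WI by (auto simp: Z_def)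
      have inW1: "f x \<in> W - S" if "x \<in> ?V - Z" for x
        using inW[OF that B(3)] that fV by auto
      let ?C = "comp_of (edges Y) (?V - Z) v" and ?D = "comp_of ?E (W - S) (f v)"
      have "?C \<subseteq> {x. f x \<in> ?D}"
      proof (rule comp_of_subset_closed)
        show "v \<in> {x. f x \<in> ?D}" using comp_of_self[OF inW1[OF v]] by simp
        fix y x assume yx: "y \<in> {x. f x \<in> ?D}" "y \<in> ?C" "(y, x) \<in> edges Y" "x \<in> ?V - Z"
        have yV: "y \<in> ?V - Z" using yx(2) comp_of_subset by fast
        obtain t where t: "t \<in> F" "f x = f y \<otimes> t" using edge yx(3) VX by blast
        have fy: "f y \<in> carrier G" using yV fV by auto
        have "f y \<otimes> t \<in> comp_of ?E ((\<otimes>) (f y) ` b t) (f y \<otimes> \<one>)"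
          using b[OF t(1)] by (intro comp_of_cayley_translate fy UC) auto
        moreover have "(\<otimes>) (f y) ` b t \<subseteq> W - S" using inW[OF yV] B(4)[OF t(1)] by auto
        ultimately have "f x \<in> comp_of ?E (W - S) (f y)"
          using comp_of_mono[of "(\<otimes>) (f y) ` b t" "W - S" ?E "f y"] fy t(2) by auto
        moreover have "comp_of ?E (W - S) (f y) = ?D"
          using yx(1) inW1[OF v] by (intro comp_of_eq[OF sE]) auto
        ultimately show "x \<in> {x. f x \<in> ?D}" by simp
      qed
      moreover have CV: "?C \<subseteq> ?V" using comp_of_subset[of "edges Y" "?V - Z" v] by auto
      ultimately have fC: "f ` ?C \<subseteq> ?D \<inter> f ` ?V" by auto
      have DW: "?D \<subseteq> W" using comp_of_subset[of ?E "W - S" "f v"] by auto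
      have "card ?C = card (f ` ?C)" using fV(1) CV by (metis card_image inj_on_subset)
      also have "\<dots> \<le> card (?D \<inter> f ` ?V)" using fC Y(2) by (intro card_mono) auto
      also have "\<dots> = sum w ?D" using sw[OF DW] by simp
      finally have "2 * card ?C \<le> sum w W" using S(3)[OF inW1[OF v]] by linarith
      also have "\<dots> = card ?V" using sw[of W] fW fV(1) by (simp add: Int_absorb1 card_image)
      finally show "2 * card ?C \<le> card ?V" .
    qed
    then have "cut Y \<le> card Z" by (rule cut_le[OF Y(2)])
    \<comment> \<open>For fixed \<open>c\<close>, \<open>x\<close> is determined by
      \<open>f x \<otimes> c\<close>, so each slice has at most \<open>card S\<close>
      elements.\<close>
    also have "Z = (\<Union>c\<in>B. {x \<in> ?V. f x \<otimes> c \<in> S})" by (auto simp: Z_def)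
    also have "card \<dots> \<le> (\<Sum>c\<in>B. card {x \<in> ?V. f x \<otimes> c \<in> S})" using B(1) by (rule card_UN_le)
    also have "\<dots> \<le> of_nat (card B) * (16 * ?z)"
    proof (rule sum_bounded_above)
      fix c assume c: "c \<in> B"
      have "card {x \<in> ?V. f x \<otimes> c \<in> S} \<le> card S"
      proof (rule card_inj_on_le)
        show "inj_on (\<lambda>x. f x \<otimes> c) {x \<in> ?V. f x \<otimes> c \<in> S}"
        proof (rule inj_onI)
          fix x y assume xy: "x \<in> {x \<in> ?V. f x \<otimes> c \<in> S}" "y \<in> {x \<in> ?V. f x \<otimes> c \<in> S}"
            "f x \<otimes> c = f y \<otimes> c"
          then have "f x = f y" using c B(2) fV(2) by (auto simp: subset_iff)
          then show "x = y" using xy fV(1) by (auto dest: inj_onD)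
        qed
        show "finite S" using S(1) W(1) finite_subset by blast
      qed auto
      then show "card {x \<in> ?V. f x \<otimes> c \<in> S} \<le> 16 * ?z" using S(2) by linarith
    qed
    finally show ?thesis by simp
  qed
  have "sep X r \<le> (16 * card B) * sep ?K ((16 * card B) * r) + 16 * card B" for r
  proof -
    have "sep X r \<le> card B * (16 * max 1 (sep ?K (card B * r)))" using main by (rule sep_leI)
    also have "max 1 (sep ?K (card B * r)) \<le> sep ?K ((16 * card B) * r) + 1"
      using monoD[OF mono_sep, of "card B * r" "(16 * card B) * r" ?K] by (simp add: le_SucI)
    finally show ?thesis by (simp add: algebra_simps)
  qed
  then show ?thesis unfolding asymp_le_def by blast
qed

lemma cayley_edge_mult:
  assumes U: "U \<subseteq> carrier G" and e: "(x, y) \<in> edges (cayley_graph G U)"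
  shows "\<exists>t \<in> U \<union> m_inv G ` U. y = x \<otimes> t"
proof -
  have c: "x \<in> carrier G" "y \<in> carrier G" using e by (auto simp: cayley_graph_def)
  obtain s where s: "s \<in> U" "y = x \<otimes> s \<or> x = y \<otimes> s" using e by (auto simp: cayley_graph_def)
  then have "y = x \<otimes> s \<or> y = x \<otimes> inv s" using U c by (auto simp: inv_solve_right)
  then show ?thesis using s(1) by auto
qed

lemma sep_asymp_le_cayley_hom:
  assumes U: "finite_generating_set G U" and K: "group K" and f: "f \<in> hom K G" "inj_on f (carrier K)"
    and S: "finite S" "S \<subseteq> carrier K"
  shows "sep (cayley_graph K S) \<lesssim>\<^sub>s sep (cayley_graph G U)"
proof (rule sep_asymp_le_cayley[OF U])
  interpret K: group K by fact
  let ?F = "f ` (S \<union> m_inv K ` S)"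
  have F: "S \<union> m_inv K ` S \<subseteq> carrier K" using S by auto
  show "finite ?F" using S by simp
  show "?F \<subseteq> carrier G" using F f(1) by (auto simp: hom_def)
  show "\<exists>t\<in>?F. f y = f x \<otimes> t" if e: "(x, y) \<in> edges (cayley_graph K S)" for x y
  proof -
    obtain t where t: "t \<in> S \<union> m_inv K ` S" "y = x \<otimes>\<^bsub>K\<^esub> t" using K.cayley_edge_mult[OF S(2) e] by blast
    moreover have "x \<in> carrier K" using e by (auto simp: cayley_graph_def)
    ultimately have "f y = f x \<otimes> f t" using F hom_mult[OF f(1)] by blast
    then show ?thesis using t by blast
  qed
qed (use f in \<open>auto simp: cayley_graph_def hom_def\<close>)

end

section \<open>The separation profile of a free product\<close>

context two_groups
begin

section \<open>Right multiplication of reduced words by a single letter\<close>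

lemma foldr_fp_inl:
  assumes "r \<in> fp_words G H" "r = [] \<or> \<not> isl (last r)" "c \<in> carrier G"
  shows "foldr (fp_cons G H) r (fp_inl G H c) = r @ fp_inl G H c"
proof (cases "c = \<one>\<^bsub>G\<^esub>")
  case True
  then show ?thesis using foldr_Nil[OF assms(1)] by (simp add: fp_inl_def)
next
  case False
  have "r @ [Inl c] \<in> fp_words G H"
    using assms False by (auto simp: fp_words_def successively_append_iff)
  from foldr_Nil[OF this] show ?thesis using False by (simp add: fp_inl_def)
qed

lemma foldr_fp_inr:
  assumes "r \<in> fp_words G H" "r = [] \<or> isl (last r)" "c \<in> carrier H"
  shows "foldr (fp_cons G H) r (fp_inr G H c) = r @ fp_inr G H c"
proof (cases "c = \<one>\<^bsub>H\<^esub>")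
  case True
  then show ?thesis using foldr_Nil[OF assms(1)] by (simp add: fp_inr_def)
next
  case False
  have "r @ [Inr c] \<in> fp_words G H"
    using assms False by (auto simp: fp_words_def successively_append_iff)
  from foldr_Nil[OF this] show ?thesis using False by (simp add: fp_inr_def)
qed

lemma fp_words_snocD: "r @ [x] \<in> fp_words G H \<Longrightarrow> r \<in> fp_words G H \<and> (r = [] \<or> isl (last r) \<noteq> isl x)"
  by (auto simp: fp_words_def successively_append_iff)

text \<open>Only the last letter is affected. A trivial \<open>a\<close> covers words not ending in
  a letter of \<open>G\<close>, and \<open>fp_inl\<close> sends a trivial product to the empty word,
  which covers cancellation.\<close>

lemma mult_fp_inl:
  assumes g: "g \<in> fp_words G H" and s: "s \<in> carrier G"
  shows "\<exists>r. \<exists>a \<in> carrier G. g = r @ fp_inl G H a \<and>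
    g \<otimes>\<^bsub>free_product G H\<^esub> fp_inl G H s = r @ fp_inl G H (a \<otimes>\<^bsub>G\<^esub> s)"
proof (cases "g = [] \<or> \<not> isl (last g)")
  case True
  then have "g \<otimes>\<^bsub>free_product G H\<^esub> fp_inl G H s = g @ fp_inl G H s"
    using foldr_fp_inl[OF g _ s] by (simp add: free_product_def)
  then show ?thesis using s by (intro exI[of _ g] bexI[of _ "\<one>\<^bsub>G\<^esub>"]) (auto simp: fp_inl_def)
next
  case False
  then obtain r b where r: "g = r @ [Inl b]"
    by (metis append_butlast_last_id isl_def)
  then have b: "b \<in> carrier G" "b \<noteq> \<one>\<^bsub>G\<^esub>" using g by (auto simp: fp_words_def)
  have "g \<otimes>\<^bsub>free_product G H\<^esub> fp_inl G H s = foldr (fp_cons G H) r (fp_inl G H (b \<otimes>\<^bsub>G\<^esub> s))"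
    using r b s fp_cons_Inl_Inl[OF b(1) s fp_words_Nil] by (simp add: free_product_def fp_inl_def)
  also have "\<dots> = r @ fp_inl G H (b \<otimes>\<^bsub>G\<^esub> s)"
    using fp_words_snocD[of r "Inl b"] g r b s by (intro foldr_fp_inl) auto
  finally show ?thesis using r b by (intro exI[of _ r] bexI[of _ b]) (auto simp: fp_inl_def)
qed

lemma mult_fp_inr:
  assumes g: "g \<in> fp_words G H" and s: "s \<in> carrier H"
  shows "\<exists>r. \<exists>a \<in> carrier H. g = r @ fp_inr G H a \<and>
    g \<otimes>\<^bsub>free_product G H\<^esub> fp_inr G H s = r @ fp_inr G H (a \<otimes>\<^bsub>H\<^esub> s)"
proof (cases "g = [] \<or> isl (last g)")
  case True
  then have "g \<otimes>\<^bsub>free_product G H\<^esub> fp_inr G H s = g @ fp_inr G H s"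
    using foldr_fp_inr[OF g _ s] by (simp add: free_product_def)
  then show ?thesis using s by (intro exI[of _ g] bexI[of _ "\<one>\<^bsub>H\<^esub>"]) (auto simp: fp_inr_def)
next
  case False
  then obtain r b where r: "g = r @ [Inr b]"
    by (metis append_butlast_last_id sum.collapse(2))
  then have b: "b \<in> carrier H" "b \<noteq> \<one>\<^bsub>H\<^esub>" using g by (auto simp: fp_words_def)
  have "g \<otimes>\<^bsub>free_product G H\<^esub> fp_inr G H s = foldr (fp_cons G H) r (fp_inr G H (b \<otimes>\<^bsub>H\<^esub> s))"
    using r b s fp_cons_Inr_Inr[OF b(1) s fp_words_Nil] by (simp add: free_product_def fp_inr_def)
  also have "\<dots> = r @ fp_inr G H (b \<otimes>\<^bsub>H\<^esub> s)"
    using fp_words_snocD[of r "Inr b"] g r b s by (intro foldr_fp_inr) auto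
  finally show ?thesis using r b by (intro exI[of _ r] bexI[of _ b]) (auto simp: fp_inr_def)
qed

section \<open>Edges of the free product as edges of copies of the factors\<close>

abbreviation fp_graph :: "'a set \<Rightarrow> 'b set \<Rightarrow> ('a + 'b) list ugraph" where
  "fp_graph S T \<equiv> cayley_graph (free_product G H) (fp_inl G H ` S \<union> fp_inr G H ` T)"

lemma fp_graph_edge:
  assumes S: "S \<subseteq> carrier G" and T: "T \<subseteq> carrier H" and gh: "(g, h) \<in> edges (fp_graph S T)"
  shows "(\<exists>r a b. (a, b) \<in> edges (cayley_graph G S) \<and> g = r @ fp_inl G H a \<and> h = r @ fp_inl G H b) \<or>
    (\<exists>r a b. (a, b) \<in> edges (cayley_graph H T) \<and> g = r @ fp_inr G H a \<and> h = r @ fp_inr G H b)"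
proof -
  let ?P = "free_product G H"
  let ?R = "\<lambda>g h. (\<exists>r a b. (a, b) \<in> edges (cayley_graph G S) \<and> g = r @ fp_inl G H a \<and> h = r @ fp_inl G H b) \<or>
    (\<exists>r a b. (a, b) \<in> edges (cayley_graph H T) \<and> g = r @ fp_inr G H a \<and> h = r @ fp_inr G H b)"
  have step: "?R g h" if g: "g \<in> fp_words G H" "g \<noteq> h"
    and s: "s \<in> fp_inl G H ` S \<union> fp_inr G H ` T" "h = g \<otimes>\<^bsub>?P\<^esub> s" for g h s
    using s(1)
  proof
    assume "s \<in> fp_inl G H ` S"
    then obtain s' where s': "s' \<in> S" "s = fp_inl G H s'" by auto
    obtain r a where ra: "a \<in> carrier G" "g = r @ fp_inl G H a" "h = r @ fp_inl G H (a \<otimes>\<^bsub>G\<^esub> s')"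
      using mult_fp_inl[OF g(1), of s'] s s' S by auto
    then have "a \<noteq> a \<otimes>\<^bsub>G\<^esub> s'" using g(2) by metis
    then have "(a, a \<otimes>\<^bsub>G\<^esub> s') \<in> edges (cayley_graph G S)"
      using ra s' S by (auto simp: cayley_graph_def)
    then show ?thesis using ra by blast
  next
    assume "s \<in> fp_inr G H ` T"
    then obtain s' where s': "s' \<in> T" "s = fp_inr G H s'" by auto
    obtain r a where ra: "a \<in> carrier H" "g = r @ fp_inr G H a" "h = r @ fp_inr G H (a \<otimes>\<^bsub>H\<^esub> s')"
      using mult_fp_inr[OF g(1), of s'] s s' T by auto
    then have "a \<noteq> a \<otimes>\<^bsub>H\<^esub> s'" using g(2) by metis
    then have "(a, a \<otimes>\<^bsub>H\<^esub> s') \<in> edges (cayley_graph H T)"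
      using ra s' T by (auto simp: cayley_graph_def)
    then show ?thesis using ra by blast
  qed
  have symG: "sym (edges (cayley_graph G S))" "sym (edges (cayley_graph H T))"
    using ugraph_cayley_graph[of G S] ugraph_cayley_graph[of H T] by (auto simp: ugraph_def)
  have R_sym: "?R g h" if "?R h g" for g h using that symG unfolding sym_def by blast
  obtain s where s: "s \<in> fp_inl G H ` S \<union> fp_inr G H ` T" "h = g \<otimes>\<^bsub>?P\<^esub> s \<or> g = h \<otimes>\<^bsub>?P\<^esub> s"
    using gh by (auto simp: cayley_graph_def)
  have "g \<in> fp_words G H" "h \<in> fp_words G H" "g \<noteq> h"
    using gh by (auto simp: cayley_graph_def free_product_def)
  then show ?thesis using step[of g h s] R_sym[OF step[of h g s]] s by metis
qed

lemma fp_graph_edge_Inl: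
  assumes "S \<subseteq> carrier G" "T \<subseteq> carrier H" "(u @ [Inl a], u @ [Inl b]) \<in> edges (fp_graph S T)"
  shows "(a, b) \<in> edges (cayley_graph G S)"
proof -
  have "a \<noteq> b" using assms(3) by (auto simp: cayley_graph_def)
  with fp_graph_edge[OF assms] show ?thesis
    by (auto simp: fp_inl_def fp_inr_def split: if_splits)
qed

lemma fp_graph_edge_Inr:
  assumes "S \<subseteq> carrier G" "T \<subseteq> carrier H" "(u @ [Inr a], u @ [Inr b]) \<in> edges (fp_graph S T)"
  shows "(a, b) \<in> edges (cayley_graph H T)"
proof -
  have "a \<noteq> b" using assms(3) by (auto simp: cayley_graph_def)
  with fp_graph_edge[OF assms] show ?thesis
    by (auto simp: fp_inl_def fp_inr_def split: if_splits)
qed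

text \<open>The ends of an edge agree up to a last letter from one factor. This is the tree
  structure: a subtree is left only from its root, towards the parent or a sibling in the same
  factor.\<close>

lemma fp_graph_edge_leaving:
  assumes S: "S \<subseteq> carrier G" and T: "T \<subseteq> carrier H" and e: "(g, h) \<in> edges (fp_graph S T)"
    and pre: "prefix (u @ [x]) g" "\<not> prefix (u @ [x]) h"
  shows "g = u @ [x] \<and> (h = u \<or> (\<exists>y. h = u @ [y] \<and> isl y = isl x))"
  using fp_graph_edge[OF S T e] pre
  by (auto simp: fp_inl_def fp_inr_def split: if_splits)

text \<open>Separating the children of \<open>u\<close> costs \<open>16 * z\<close> vertices for
  each factor, and \<open>u\<close> is one more.\<close>

lemma sep_fp_graph:
  assumes S: "S \<subseteq> carrier G" and T: "T \<subseteq> carrier H"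
    and z: "z \<ge> 1" "sep (cayley_graph G S) r \<le> z" "sep (cayley_graph H T) r \<le> z"
  shows "sep (fp_graph S T) r \<le> 32 * z + 1"
proof (rule sep_leI)
  fix Y assume Y: "ugraph_subgraph Y (fp_graph S T)" and fin: "finite (verts Y)" and card: "card (verts Y) \<le> r"
  let ?V = "verts Y" and ?E = "edges Y"
  have VP: "?V \<subseteq> fp_words G H" and EP: "?E \<subseteq> edges (fp_graph S T)" and sE: "sym ?E" and EV: "?E \<subseteq> ?V \<times> ?V"
    using Y by (auto simp: ugraph_subgraph_def ugraph_def cayley_graph_def free_product_def)
  show "cut Y \<le> 32 * z + 1"
  proof (cases "?V = {}")
    case True
    then show ?thesis using cut_le_card[OF fin] by simp
  next
    case False
    define D where "D u = {v \<in> ?V. prefix u v}" for u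
    have fD: "finite (D u)" for u using fin by (auto simp: D_def)
    have n: "card ?V > 0" using False fin by (simp add: card_gt_0_iff)
    let ?heavy = "\<lambda>u. card ?V < 2 * card (D u)"
    have "?heavy []" using n by (simp add: D_def)
    moreover have "length u < Suc (Max (length ` ?V))" if "?heavy u" for u
    proof -
      have "D u \<noteq> {}" using that by auto
      then obtain v where "v \<in> ?V" "prefix u v" by (auto simp: D_def)
      moreover have "length v \<le> Max (length ` ?V)" using fin \<open>v \<in> ?V\<close> by simp
      ultimately show ?thesis using prefix_length_le[of u v] by linarith
    qed
    ultimately obtain u where u: "?heavy u" "\<And>u'. ?heavy u' \<Longrightarrow> length u' \<le> length u"
      using ex_has_greatest_nat[of ?heavy "[]" length] by blast
    have light: "2 * card (D (u @ [x])) \<le> card ?V" for x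
      using u(2)[of "u @ [x]"] by (auto simp: not_less[symmetric])
    \<comment> \<open>Only the children of \<open>u\<close> that are vertices matter: below a
      missing child no edge leaves the subtree.\<close>
    define A where "A = {v \<in> ?V. \<exists>x. v = u @ [x]}"
    define AL where "AL = {v \<in> ?V. \<exists>a. v = u @ [Inl a]}"
    define AR where "AR = {v \<in> ?V. \<exists>a. v = u @ [Inr a]}"
    have fA: "finite A" "finite AL" "finite AR" using fin by (auto simp: A_def AL_def AR_def)
    have A: "A = AL \<union> AR"
      by (auto simp: A_def AL_def AR_def) (metis sum.exhaust)
    \<comment> \<open>Subtrees below distinct children are disjoint, so the weight of a set of
      children counts the vertices below it.\<close>
    define w where "w v = card (D v)" for v
    have sw: "sum w B = card (\<Union>v\<in>B. D v)" if "B \<subseteq> A" for B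
    proof -
      have "D v \<inter> D v' = {}" if "v \<in> A" "v' \<in> A" "v \<noteq> v'" for v v'
        using that by (auto simp: D_def A_def prefix_def)
      then show ?thesis
        unfolding w_def using that fA fD
        by (intro card_UN_disjoint[symmetric]) (auto intro: finite_subset)
    qed
    have sw_le: "sum w B \<le> card ?V" if "B \<subseteq> A" for B
      using sw[OF that] fin by (auto intro!: card_mono simp: D_def)
    have cAL: "card AL \<le> r" and cAR: "card AR \<le> r"
      using card card_mono[OF fin, of AL] card_mono[OF fin, of AR] by (auto simp: AL_def AR_def)
    obtain YL where YL: "YL \<subseteq> AL" "card YL \<le> 16 * z"
      "\<And>v. v \<in> AL - YL \<Longrightarrow> 2 * sum w (comp_of ?E (AL - YL) v) \<le> sum w AL"
    proof (rule weighted_separator_sep[OF ugraph_cayley_graph[of G S] fA(2) cAL sE, of "projl \<circ> last" z w])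
      show "inj_on (projl \<circ> last) AL" by (auto simp: inj_on_def AL_def)
      show "(projl \<circ> last) ` AL \<subseteq> verts (cayley_graph G S)"
        using VP by (force simp: AL_def cayley_graph_def fp_words_def)
      show "((projl \<circ> last) x, (projl \<circ> last) y) \<in> edges (cayley_graph G S)"
        if "x \<in> AL" "y \<in> AL" "(x, y) \<in> ?E" for x y
        using that EP fp_graph_edge_Inl[OF S T, of u] by (auto simp: AL_def)
    qed (use z in auto)
    obtain YR where YR: "YR \<subseteq> AR" "card YR \<le> 16 * z"
      "\<And>v. v \<in> AR - YR \<Longrightarrow> 2 * sum w (comp_of ?E (AR - YR) v) \<le> sum w AR"
    proof (rule weighted_separator_sep[OF ugraph_cayley_graph[of H T] fA(3) cAR sE, of "projr \<circ> last" z w])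
      show "inj_on (projr \<circ> last) AR" by (auto simp: inj_on_def AR_def)
      show "(projr \<circ> last) ` AR \<subseteq> verts (cayley_graph H T)"
        using VP by (force simp: AR_def cayley_graph_def fp_words_def)
      show "((projr \<circ> last) x, (projr \<circ> last) y) \<in> edges (cayley_graph H T)"
        if "x \<in> AR" "y \<in> AR" "(x, y) \<in> ?E" for x y
        using that EP fp_graph_edge_Inr[OF S T, of u] by (auto simp: AR_def)
    qed (use z in auto)
    define B where "B = A - YL - YR"
    have BLR: "B = (AL - YL) \<union> (AR - YR)"
      using YL(1) YR(1) unfolding B_def A by (auto simp: AL_def AR_def)
    \<comment> \<open>Hence a component of \<open>B\<close> stays on one side, and a separator for
      that side alone bounds its weight.\<close>
    have noLR: "(y, x) \<notin> ?E" "(x, y) \<notin> ?E" if yx: "y \<in> AL" "x \<in> AR" for x y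
    proof -
      show "(y, x) \<notin> ?E"
      proof
        assume "(y, x) \<in> ?E"
        moreover obtain a b where "y = u @ [Inl a]" "x = u @ [Inr b]" using yx by (auto simp: AL_def AR_def)
        ultimately show False
          using fp_graph_edge_leaving[OF S T, of y x u "Inl a"] EP by auto
      qed
      then show "(x, y) \<notin> ?E" using sE by (meson symD)
    qed
    have comp_light: "2 * sum w (comp_of ?E B v) \<le> card ?V" if v: "v \<in> B" for v
    proof (cases "v \<in> AL - YL")
      case True
      have sub: "comp_of ?E B v \<subseteq> AL - YL"
        by (rule comp_of_subset_closed[OF True]) (use noLR BLR in auto)
      have "comp_of ?E B v \<subseteq> comp_of ?E (AL - YL) v"
        by (rule comp_of_subset_comp_of[OF sub v])
      then have "sum w (comp_of ?E B v) \<le> sum w (comp_of ?E (AL - YL) v)"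
        using fA comp_of_subset[of ?E "AL - YL" v] by (intro sum_mono2) (auto intro: finite_subset)
      then show ?thesis using YL(3)[OF True] sw_le[of AL] A by auto
    next
      case False
      then have vR: "v \<in> AR - YR" using v BLR by auto
      have sub: "comp_of ?E B v \<subseteq> AR - YR"
        by (rule comp_of_subset_closed[OF vR]) (use noLR BLR in auto)
      have "comp_of ?E B v \<subseteq> comp_of ?E (AR - YR) v"
        by (rule comp_of_subset_comp_of[OF sub v])
      then have "sum w (comp_of ?E B v) \<le> sum w (comp_of ?E (AR - YR) v)"
        using fA comp_of_subset[of ?E "AR - YR" v] by (intro sum_mono2) (auto intro: finite_subset)
      then show ?thesis using YR(3)[OF vR] sw_le[of AR] A by auto
    qed
    \<comment> \<open>Deleting \<open>u\<close> also cuts off the less than half of the vertices not below \<open>u\<close>.\<close>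
    define Z where "Z = YL \<union> YR \<union> ({u} \<inter> ?V)"
    have cZ: "card Z \<le> 32 * z + 1"
    proof -
      have "card Z \<le> card YL + card YR + card ({u} \<inter> ?V)"
        unfolding Z_def using card_Un_le[of "YL \<union> YR" "{u} \<inter> ?V"] card_Un_le[of YL YR] by linarith
      moreover have "card ({u} \<inter> ?V) \<le> 1" using card_mono[of "{u}" "{u} \<inter> ?V"] by simp
      ultimately show ?thesis using YL(2) YR(2) by linarith
    qed
    have "separates Y Z"
      unfolding separates_iff
    proof (intro conjI ballI)
      show "Z \<subseteq> ?V" using YL(1) YR(1) by (auto simp: Z_def AL_def AR_def)
      fix v assume v: "v \<in> ?V - Z"
      let ?W = "?V - Z"
      let ?C = "comp_of ?E ?W v"
      have uW: "u \<notin> ?W" by (auto simp: Z_def)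
      have AW: "A \<inter> ?W = B" using v by (auto simp: B_def Z_def A_def)
      have leave: "g = u' @ [x] \<and> (h = u' \<or> (\<exists>y. h = u' @ [y] \<and> isl y = isl x))"
        if "(g, h) \<in> ?E" "prefix (u' @ [x]) g" "\<not> prefix (u' @ [x]) h" for g h u' x
        using fp_graph_edge_leaving[OF S T] that EP by blast
      \<comment> \<open>The subtree below \<open>u\<close> is entered only at \<open>u\<close>,
        which is not in \<open>?W\<close>; for \<open>u = []\<close> nothing lies outside
        it.\<close>
      have outside: "x \<notin> D u" if yx: "y \<in> ?V - D u" "(y, x) \<in> ?E" "x \<in> ?W" for y x
      proof
        assume x: "x \<in> D u"
        then have xy: "prefix u x" "\<not> prefix u y" "(x, y) \<in> ?E"
          using yx sE by (auto simp: D_def dest: symD)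
        then have "u \<noteq> []" by auto
        then obtain u' c where "u = u' @ [c]" by (metis rev_exhaust)
        then have "x = u" using leave[OF xy(3)] xy by auto
        then show False using yx uW by simp
      qed
      show "2 * card ?C \<le> card ?V"
      proof (cases "v \<in> D u")
        case False
        have "?C \<subseteq> ?V - D u"
        proof (rule comp_of_subset_closed)
          show "v \<in> ?V - D u" using False v by auto
        qed (use outside in auto)
        then have "card ?C \<le> card (?V - D u)" using fin by (intro card_mono) auto
        also have "\<dots> = card ?V - card (D u)" using fD by (intro card_Diff_subset) (auto simp: D_def)
        finally show ?thesis using u(1) by linarith
      next
        case True
        then have "prefix u v" "v \<noteq> u" using v uW by (auto simp: D_def)
        then obtain c where c: "prefix (u @ [c]) v"
          by (metis append_one_prefix prefix_length_less prefix_order.le_neq_trans)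
        \<comment> \<open>If the child above \<open>v\<close> survives, the component can pass to
          siblings, and \<open>comp_light\<close> bounds their subtrees together; if not, it is
          confined to one subtree, which is light by the maximality of \<open>u\<close>.\<close>
        define Q where "Q = (if u @ [c] \<in> B then \<Union>k\<in>comp_of ?E B (u @ [c]). D k else D (u @ [c]))"
        have "?C \<subseteq> Q"
        proof (rule comp_of_subset_closed)
          show "v \<in> Q" using c v comp_of_self[of "u @ [c]" B ?E] by (auto simp: Q_def D_def)
          fix y x assume yx: "y \<in> Q" "y \<in> ?C" "(y, x) \<in> ?E" "x \<in> ?W"
          have yW: "y \<in> ?W" using yx(2) comp_of_subset by fast
          obtain k where k: "y \<in> D k" "D k \<subseteq> Q" "k = u @ [c] \<or> u @ [c] \<in> B \<and> k \<in> comp_of ?E B (u @ [c])"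
            using yx(1) by (auto simp: Q_def split: if_splits)
          have "\<exists>d. k = u @ [d]" using k(3) comp_of_subset[of ?E B "u @ [c]"] by (auto simp: B_def A_def)
          then obtain d where d: "k = u @ [d]" by blast
          show "x \<in> Q"
          proof (cases "prefix k x")
            case True
            then show ?thesis using k(2) yx(4) by (auto simp: D_def)
          next
            case nk: False
            have "prefix (u @ [d]) y" "\<not> prefix (u @ [d]) x" using k(1) nk d by (auto simp: D_def)
            from leave[OF yx(3) this] have *: "y = k" "x = u \<or> (\<exists>e. x = u @ [e])" using d by auto
            then have "x \<in> A" using yx(4) uW by (auto simp: A_def)
            then have xB: "x \<in> B" using AW yx(4) by blast
            have kB: "k \<in> B" using AW yW * d by (auto simp: A_def)
            have cB: "u @ [c] \<in> B" using k(3) kB by auto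
            then have "k \<in> comp_of ?E B (u @ [c])" using k(3) comp_of_self by fast
            then have "x \<in> comp_of ?E B (u @ [c])" using comp_of_step[OF _ _ xB] yx(3) * by metis
            moreover have "x \<in> D x" using yx(4) by (auto simp: D_def)
            ultimately show ?thesis using cB by (auto simp: Q_def)
          qed
        qed
        moreover have "finite Q"
        proof (rule finite_subset[OF _ fin])
          show "Q \<subseteq> ?V" by (auto simp: Q_def D_def)
        qed
        ultimately have "card ?C \<le> card Q" by (intro card_mono)
        moreover have "2 * card Q \<le> card ?V"
        proof (cases "u @ [c] \<in> B")
          case True
          have "comp_of ?E B (u @ [c]) \<subseteq> A"
            using comp_of_subset[of ?E B "u @ [c]"] by (auto simp: B_def)
          from sw[OF this] comp_light[OF True] show ?thesis using True by (simp add: Q_def)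
        qed (use light in \<open>simp add: Q_def\<close>)
        ultimately show ?thesis by linarith
      qed
    qed
    then show ?thesis using cut_le[OF fin] cZ le_trans by blast
  qed
qed

end

theorem theorem1p3:
  fixes G :: "('a, 'm) monoid_scheme" and H :: "('b, 'n) monoid_scheme"
    and S :: "'a set" and T :: "'b set" and U :: "('a + 'b) list set"
  assumes "group G" and "group H"
    and "finite_generating_set G S"
    and "finite_generating_set H T"
    and "finite_generating_set (free_product G H) U"
  shows "(sep (cayley_graph (free_product G H) U)) \<simeq>\<^sub>s
    (\<lambda>r. max (sep (cayley_graph G S) r) (sep (cayley_graph H T) r))"
proof -
  interpret two_groups G H using assms by (simp add: two_groups_def)
  let ?P = "free_product G H"
  let ?m = "\<lambda>r. max (sep (cayley_graph G S) r) (sep (cayley_graph H T) r)"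
  let ?A = "fp_inl G H ` S \<union> fp_inr G H ` T"
  interpret P: group ?P by (rule group_free_product)
  have S: "finite S" "S \<subseteq> carrier G" and T: "finite T" "T \<subseteq> carrier H"
    using assms by (auto simp: finite_generating_set_def)
  have A: "finite ?A" "?A \<subseteq> carrier ?P"
    using finite_generating_set_free_product[OF assms(3,4)] by (auto simp: finite_generating_set_def)
  \<comment> \<open>The constant comes from
    \<open>32 * max 1 m + 1 \<le> 32 * m + 33\<close>.\<close>
  have "sep (fp_graph S T) r \<le> 33 * ?m (33 * r) + 33" for r
  proof -
    have "sep (fp_graph S T) r \<le> 32 * max 1 (?m r) + 1"
      by (rule sep_fp_graph[OF S(2) T(2)]) auto
    moreover have "?m r \<le> ?m (33 * r)"
      using monoD[OF mono_max[OF mono_sep mono_sep], of r "33 * r"] by simp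
    ultimately show ?thesis by linarith
  qed
  then have "sep (fp_graph S T) \<lesssim>\<^sub>s ?m" unfolding asymp_le_def by blast
  moreover have "sep (cayley_graph ?P U) \<lesssim>\<^sub>s sep (fp_graph S T)"
  proof (rule P.sep_asymp_le_cayley[OF finite_generating_set_free_product[OF assms(3,4)]])
    show "finite (U \<union> m_inv ?P ` U)" "U \<union> m_inv ?P ` U \<subseteq> carrier ?P"
      using assms(5) by (auto simp: finite_generating_set_def)
    show "\<exists>t\<in>U \<union> m_inv ?P ` U. id y = id x \<otimes>\<^bsub>?P\<^esub> t" if "(x, y) \<in> edges (cayley_graph ?P U)" for x y
      using P.cayley_edge_mult[OF _ that] assms(5) by (simp add: finite_generating_set_def)
  qed (auto simp: cayley_graph_def)
  ultimately have 1: "sep (cayley_graph ?P U) \<lesssim>\<^sub>s ?m"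
    using asymp_le_trans mono_max[OF mono_sep mono_sep] by blast
  have "sep (cayley_graph G S) \<lesssim>\<^sub>s sep (cayley_graph ?P U)"
    by (rule P.sep_asymp_le_cayley_hom[OF assms(5) assms(1) fp_inl_hom fp_inj(1) S])
  moreover have "sep (cayley_graph H T) \<lesssim>\<^sub>s sep (cayley_graph ?P U)"
    by (rule P.sep_asymp_le_cayley_hom[OF assms(5) assms(2) fp_inr_hom fp_inj(2) T])
  ultimately have "?m \<lesssim>\<^sub>s sep (cayley_graph ?P U)" using mono_sep by (rule asymp_le_max)
  then show ?thesis using 1 by (simp add: asymp_eq_def)
qed

end
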